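(* Let $\pi=(d_1\le\dots\le d_n)$ be a graphical degree sequence, set $d_0=0$, and let $k\ge2$ be an integer such that $kn$ is even. Suppose: (i) $d_1\ge k$; (ii) for all integers $a,b,q$ with $0\le a<\frac12 n$, $0\le b\le n-a$ and $\max\{0,a(k-b)+2\}\le q\le n-a-b$ such that $\sum_{i=1}^{b}d_i\le kb+ab-ka+q-2$, the following holds. Setting $r=a+k+q-2$ and $s=n-\max\{0,b-k+1\}-\max\{0,q-1\}-1$: if either ($r\le s$ and $d_b\le r$) or ($r>s$ and $d_{n-a-b}\le s$), then $d_{n-a}\ge\max\{r,s\}+1$. Then $\pi$ is forcibly $k$-factor graphical, i.e., every graph with degree sequence $\pi$ has a $k$-factor.
   Context: Graphs are finite, undirected, without loops or multiple edges. A sequence of integers $\pi=(d_1,\dots,d_n)$ is graphical if it is the sequence of vertex degrees (here in nondecreasing order) of some graph on $n$ vertices; such a graph is a realization of $\pi$. A $k$-factor of a graph $G$ is a spanning subgraph of $G$ in which every vertex has degree exactly $k$. $\pi$ is forcibly $k$-factor graphical if every realization of $\pi$ has a $k$-factor. By convention $d_0=0$, and the empty sum (when $b=0$) is $0$. *)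

theory Defs
  imports "HOL-Library.Multiset"
begin

text \<open>A finite simple graph is given by a vertex set and a set of two-element vertex sets.\<close>

definition simple_graph :: "'a set \<Rightarrow> 'a set set \<Rightarrow> bool" where
  "simple_graph V E \<longleftrightarrow> finite V \<and> (\<forall>e\<in>E. e \<subseteq> V \<and> card e = 2)"

definition degree :: "'a set set \<Rightarrow> 'a \<Rightarrow> nat" where
  "degree E v = card {e \<in> E. v \<in> e}"

definition degree_sequence :: "'a set \<Rightarrow> 'a set set \<Rightarrow> int list" where
  "degree_sequence V E = sorted_list_of_multiset (image_mset (\<lambda>v. int (degree E v)) (mset_set V))"

definition realization :: "'a set \<Rightarrow> 'a set set \<Rightarrow> int list \<Rightarrow> bool" where
  "realization V E \<pi> \<longleftrightarrow> simple_graph V E \<and> degree_sequence V E = \<pi>"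

text \<open>Every finite graph is isomorphic to one whose vertices are natural numbers, so quantifying
  over these is no restriction. Note that a graphical sequence is nondecreasing by definition.\<close>

definition graphical :: "int list \<Rightarrow> bool" where
  "graphical \<pi> \<longleftrightarrow> (\<exists>(V :: nat set) E. realization V E \<pi>)"

text \<open>\<open>F\<close> is the edge set of the spanning subgraph.\<close>

definition is_k_factor :: "nat \<Rightarrow> 'a set \<Rightarrow> 'a set set \<Rightarrow> 'a set set \<Rightarrow> bool" where
  "is_k_factor k V E F \<longleftrightarrow> F \<subseteq> E \<and> (\<forall>v\<in>V. degree F v = k)"

text \<open>A definition cannot quantify over the type of vertices, hence the type argument.\<close>

definition forcibly_k_factor_graphical :: "'a itself \<Rightarrow> nat \<Rightarrow> int list \<Rightarrow> bool" where
  "forcibly_k_factor_graphical _ k \<pi> \<longleftrightarrow>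
     (\<forall>(V :: 'a set) E. realization V E \<pi> \<longrightarrow> (\<exists>F. is_k_factor k V E F))"

text \<open>The entries are numbered from 1, with the convention \<open>d\<^sub>0 = 0\<close>; only indices
  from 0 to the length of the list are meaningful.\<close>

definition seq_entry :: "int list \<Rightarrow> int \<Rightarrow> int" where
  "seq_entry \<pi> i = (if i = 0 then 0 else \<pi> ! nat (i - 1))"

end

theory Submission
  imports Defs
begin

text \<open>
  A graph without a \<open>k\<close>-factor contains an obstruction, the barrier of Belck and Tutte: disjoint sets
  \<open>S\<close>, \<open>T\<close> of vertices, of sizes \<open>a\<close> and \<open>b\<close>, such that
  \<open>k a - k b + (\<Sum>t\<in>T. d_{G-S}(t)) - q \<le> -2\<close>, where \<open>q\<close> counts the odd pieces of \<open>G - S - T\<close>. Among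
  all barriers one maximizes \<open>a - b\<close> (\<open>extremal_barrier\<close>). Moving a vertex from \<open>T\<close> to the rest, or from
  the rest to \<open>S\<close>, then must destroy the barrier. The first fact bounds the degree of every vertex
  of \<open>T\<close> by \<open>r = a + k + q - 2\<close>. The second one says that a vertex outside \<open>S\<close> and \<open>T\<close> has at most
  \<open>k - 1\<close> neighbours in \<open>T\<close>; it also misses a vertex in every odd piece other than its own, so its
  degree is at most \<open>s\<close> (\<open>separated_degree_bound\<close>). For the sorted degree sequence this means
  \<open>d_b \<le> r\<close>, \<open>d_{n-a-b} \<le> s\<close> and \<open>d_{n-a} \<le> max r s\<close>, while the barrier inequality provides the
  premises on \<open>a\<close>, \<open>b\<close> and \<open>q\<close>. This contradicts the degree condition.

  The existence of a barrier is the hard half of the \<open>f\<close>-factor theorem, proved here as a min-max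
  theorem (\<open>factor_min_max\<close>) for \<open>min (\<Sum>v. \<bar>d_F(v) - f(v)\<bar>)\<close> over all subgraphs \<open>F\<close> and arbitrary integer
  targets \<open>f\<close>. The tool is an exchange property of degree vectors of subgraphs: a unit step of one
  vector towards another one can be completed, by a second unit step, to a degree vector, and the
  opposite two steps are possible at the other end (\<open>degree_exchange\<close>).
  If some vertex exceeds its target in an optimal subgraph but falls short of it in none, it
  can be deleted and put into \<open>S\<close>, by induction (\<open>certified_if_excess_vertex\<close>). If some vertex falls short but never
  exceeds, passing to complements reduces this to the former case and puts the vertex into \<open>T\<close>.
  Otherwise an argument in the style of Gallai's lemma shows that ``equal, or never both off target
  in an optimal subgraph'' is an equivalence relation between the vertices that can miss their
  target, that adjacent ones are related and have no other neighbours, and that each class contributes at most \<open>1\<close> to the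
  deviation (\<open>certified_if_balanced\<close>); so \<open>S = T = {}\<close> and these classes
  attain the minimum.

  Connected components never occur. The pieces of \<open>G - S - T\<close> are the classes of a labelling that is
  constant along edges; this is all that the parity and counting arguments use, and such
  labellings are easily restricted or merged when \<open>S\<close> or \<open>T\<close> changes.
\<close>

section \<open>Degrees and neighbourhoods\<close>

definition neighbours :: "'a set set \<Rightarrow> 'a \<Rightarrow> 'a set" where
  "neighbours E v = {w. {v, w} \<in> E}"

lemma simple_graph_finite_edges:
  assumes "simple_graph V E" shows "finite E"
  using assms unfolding simple_graph_def by (meson Pow_iff finite_Pow_iff finite_subset subsetI)

lemma simple_graph_edge_ends_differ:
  assumes "simple_graph V E" "{u, v} \<in> E" shows "u \<noteq> v" "u \<in> V" "v \<in> V"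
proof -
  have e: "{u, v} \<subseteq> V" "card {u, v} = 2" using assms unfolding simple_graph_def by blast+
  then show "u \<in> V" "v \<in> V" by auto
  show "u \<noteq> v" using e(2) by auto
qed

lemma neighbours_in:
  assumes "simple_graph V E"
  shows "neighbours E v \<subseteq> V - {v}" "finite (neighbours E v)"
proof -
  show *: "neighbours E v \<subseteq> V - {v}"
    unfolding neighbours_def using simple_graph_edge_ends_differ[OF assms] by blast
  then show "finite (neighbours E v)"
    using assms finite_subset unfolding simple_graph_def by (metis finite_Diff)
qed

lemma neighbours_sym: "w \<in> neighbours E v \<longleftrightarrow> v \<in> neighbours E w"
  by (simp add: neighbours_def insert_commute)

lemma degree_eq_card_neighbours:
  assumes "simple_graph V E"
  shows "degree E v = card (neighbours E v)"
proof -
  have "bij_betw (\<lambda>w. {v, w}) (neighbours E v) {e \<in> E. v \<in> e}"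
  proof (rule bij_betwI')
    fix x y assume "x \<in> neighbours E v" "y \<in> neighbours E v"
    then show "({v, x} = {v, y}) = (x = y)" by (auto simp: doubleton_eq_iff)
  next
    fix x assume "x \<in> neighbours E v"
    then show "{v, x} \<in> {e \<in> E. v \<in> e}" by (simp add: neighbours_def)
  next
    fix e assume e: "e \<in> {e \<in> E. v \<in> e}"
    then have "card e = 2" using assms unfolding simple_graph_def by blast
    then obtain x y where "e = {x, y}" by (meson card_2_iff)
    then show "\<exists>x\<in>neighbours E v. e = {v, x}"
      using e unfolding neighbours_def by (auto simp: insert_commute)
  qed
  then show ?thesis unfolding degree_def using bij_betw_same_card by force
qed

lemma degree_insert:
  assumes "finite F" "e \<notin> F"
  shows "degree (insert e F) v = degree F v + of_bool (v \<in> e)"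
proof -
  have "{x \<in> insert e F. v \<in> x} = (if v \<in> e then insert e {x \<in> F. v \<in> x} else {x \<in> F. v \<in> x})"
    by auto
  then show ?thesis unfolding degree_def using assms by simp
qed

lemma degree_remove:
  assumes "finite F" "e \<in> F"
  shows "degree F v = degree (F - {e}) v + of_bool (v \<in> e)"
proof -
  have "insert e (F - {e}) = F" using assms by blast
  then show ?thesis using degree_insert[of "F - {e}" e v] assms(1) by fastforce
qed

lemma degree_Un_Int:
  assumes "finite F" "finite F'"
  shows "degree F v + degree F' v = degree (F \<union> F') v + degree (F \<inter> F') v"
proof -
  have "{e \<in> F \<union> F'. v \<in> e} = {e \<in> F. v \<in> e} \<union> {e \<in> F'. v \<in> e}"
       "{e \<in> F \<inter> F'. v \<in> e} = {e \<in> F. v \<in> e} \<inter> {e \<in> F'. v \<in> e}" by auto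
  then show ?thesis
    using card_Un_Int[of "{e \<in> F. v \<in> e}" "{e \<in> F'. v \<in> e}"] assms unfolding degree_def by simp
qed

lemma sum_degree_eq_sum_edges:
  assumes "finite F" "finite K"
  shows "(\<Sum>v\<in>K. degree F v) = (\<Sum>e\<in>F. card (e \<inter> K))"
proof -
  have "(\<Sum>v\<in>K. degree F v) = (\<Sum>v\<in>K. \<Sum>e\<in>F. of_bool (v \<in> e))"
    unfolding degree_def using assms by (simp add: Int_def)
  also have "\<dots> = (\<Sum>e\<in>F. \<Sum>v\<in>K. of_bool (v \<in> e))" by (rule sum.swap)
  also have "\<dots> = (\<Sum>e\<in>F. card (e \<inter> K))"
    using assms by (simp add: Int_commute)
  finally show ?thesis .
qed

text \<open>An edge of \<open>F\<close> has either both ends in \<open>K\<close> or none, so the handshake count applies to \<open>K\<close> alone.\<close>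

lemma even_sum_degree:
  assumes "simple_graph V E" "F \<subseteq> E" "K \<subseteq> V"
    and "\<And>x y. {x, y} \<in> E \<Longrightarrow> x \<in> K \<Longrightarrow> y \<in> K"
  shows "even (\<Sum>v\<in>K. degree F v)"
proof -
  have fin: "finite F" "finite K"
    using assms simple_graph_finite_edges finite_subset unfolding simple_graph_def by metis+
  have "even (card (e \<inter> K))" if "e \<in> F" for e
  proof -
    have "card e = 2" using that assms unfolding simple_graph_def by blast
    then obtain x y where e: "e = {x, y}" "x \<noteq> y" by (meson card_2_iff)
    then have "x \<in> K \<longleftrightarrow> y \<in> K" using assms(2,4) that by (metis insert_commute subsetD)
    then have "e \<inter> K = (if x \<in> K then {x, y} else {})" using e by auto
    then show ?thesis using e by simp
  qed
  then show ?thesis unfolding sum_degree_eq_sum_edges[OF fin] by (intro dvd_sum) auto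
qed

section \<open>The exchange property of degree vectors\<close>

definition unit :: "'a \<Rightarrow> int \<Rightarrow> 'a \<Rightarrow> int" where
  "unit u s v = (if v = u then s else 0)"

lemma degree_insert_unit:
  assumes "finite F" "{u, z} \<notin> F" "u \<noteq> z"
  shows "int (degree (insert {u, z} F) v) = int (degree F v) + unit u 1 v + unit z 1 v"
  using degree_insert[OF assms(1,2), of v] assms(3) by (auto simp: unit_def)

lemma degree_remove_unit:
  assumes "finite F" "{u, z} \<in> F" "u \<noteq> z"
  shows "int (degree (F - {{u, z}}) v) = int (degree F v) + unit u (-1) v + unit z (-1) v"
  using degree_remove[OF assms(1,2), of v] assms(3) by (auto simp: unit_def)

text \<open>One step of an alternating trail: an edge at \<open>u\<close> in which \<open>F\<close> and \<open>F'\<close> differ is switched in \<open>F\<close>,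
  with the sign \<open>s\<close> that brings the degree at \<open>u\<close> closer to that in \<open>F'\<close>. The other end \<open>z\<close> of the edge
  is changed by the same sign, perhaps in the wrong direction.\<close>

lemma alternating_step:
  assumes "finite F" "finite F'" "\<forall>e \<in> F \<union> F'. card e = 2"
    and "s = 1 \<or> s = -1" "s * (int (degree F' u) - int (degree F u)) > 0"
  obtains F0 z where "z \<noteq> u" "F \<inter> F' \<subseteq> F0" "F0 \<subseteq> F \<union> F'"
    "card (F0 - F' \<union> (F' - F0)) < card (F - F' \<union> (F' - F))"
    "\<And>v. int (degree F0 v) = int (degree F v) + unit u s v + unit z s v"
proof -
  have "\<exists>e. u \<in> e \<and> (if s = 1 then e \<in> F' - F else e \<in> F - F')"
  proof (rule ccontr)
    assume "\<not> ?thesis"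
    then have "s = 1 \<Longrightarrow> {e \<in> F'. u \<in> e} \<subseteq> {e \<in> F. u \<in> e}"
      "s = -1 \<Longrightarrow> {e \<in> F. u \<in> e} \<subseteq> {e \<in> F'. u \<in> e}" by auto
    then have "s = 1 \<Longrightarrow> degree F' u \<le> degree F u" "s = -1 \<Longrightarrow> degree F u \<le> degree F' u"
      unfolding degree_def using assms(1,2) by (auto intro!: card_mono)
    then show False using assms(4,5) by auto
  qed
  then obtain e where e: "u \<in> e" "if s = 1 then e \<in> F' - F else e \<in> F - F'" by blast
  then have "card e = 2" using assms(3) by (metis DiffD1 UnI1 UnI2)
  then obtain z where z: "e = {u, z}" "z \<noteq> u" using e(1) by (metis card_2_iff doubleton_eq_iff insertE singletonD)
  define F0 where "F0 = (if s = 1 then insert e F else F - {e})"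
  show thesis
  proof
    show "z \<noteq> u" by fact
    show "F \<inter> F' \<subseteq> F0" "F0 \<subseteq> F \<union> F'" using e(2) unfolding F0_def by (auto split: if_splits)
    have "F0 - F' \<union> (F' - F0) \<subset> F - F' \<union> (F' - F)"
      using e(2) unfolding F0_def by (auto split: if_splits)
    then show "card (F0 - F' \<union> (F' - F0)) < card (F - F' \<union> (F' - F))"
      using assms(1,2) by (intro psubset_card_mono) auto
    show "int (degree F0 v) = int (degree F v) + unit u s v + unit z s v" for v
    proof (cases "s = 1")
      case True
      then show ?thesis using degree_insert_unit[OF assms(1), of u z v] e(2) z
        unfolding F0_def by simp
    next
      case False
      then have "s = -1" using assms(4) by blast
      then show ?thesis using degree_remove_unit[OF assms(1), of u z v] e(2) z
        unfolding F0_def by simp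
    qed
  qed
qed

text \<open>An alternating trail from \<open>u\<close> is followed by induction on the symmetric difference: if the step
  at \<open>z\<close> is in the wrong direction, the induction hypothesis, applied at \<open>z\<close> with the opposite sign,
  cancels it and replaces it by a change at \<open>w\<close>. The last conclusion says that the second step,
  at \<open>w\<close>, also goes towards \<open>F'\<close>, after the first one has been taken into account.\<close>

lemma degree_exchange_one_sided:
  assumes "finite F" "finite F'" "\<forall>e \<in> F \<union> F'. card e = 2"
    and "s = 1 \<or> s = -1" "s * (int (degree F' u) - int (degree F u)) > 0"
  shows "\<exists>F1 w t. F \<inter> F' \<subseteq> F1 \<and> F1 \<subseteq> F \<union> F' \<and> (t = 1 \<or> t = -1) \<and>
     (\<forall>v. int (degree F1 v) = int (degree F v) + unit u s v + unit w t v) \<and>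
     t * (int (degree F' w) - int (degree F w) - unit u s w) > 0"
  using assms
proof (induction "card (F - F' \<union> (F' - F))" arbitrary: F u s rule: less_induct)
  case less
  obtain F0 z where z: "z \<noteq> u" "F \<inter> F' \<subseteq> F0" "F0 \<subseteq> F \<union> F'"
    "card (F0 - F' \<union> (F' - F0)) < card (F - F' \<union> (F' - F))"
    and deg0: "\<And>v. int (degree F0 v) = int (degree F v) + unit u s v + unit z s v"
    using alternating_step[OF less.prems] by metis
  show ?case
  proof (cases "s * (int (degree F' z) - int (degree F z)) > 0")
    case True
    then show ?thesis using z deg0 less.prems(4)
      by (intro exI[of _ F0] exI[of _ z] exI[of _ s]) (auto simp: unit_def)
  next
    case False
    have over: "(- s) * (int (degree F' z) - int (degree F0 z)) > 0"
      using False deg0[of z] z(1) less.prems(4) by (auto simp: unit_def)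
    have "finite F0" "\<forall>e \<in> F0 \<union> F'. card e = 2"
      using z less.prems by (auto intro: finite_subset)
    moreover have "- s = 1 \<or> - s = -1" using less.prems(4) by auto
    ultimately obtain F1 w t where F1: "F0 \<inter> F' \<subseteq> F1" "F1 \<subseteq> F0 \<union> F'" "t = 1 \<or> t = -1"
      "\<And>v. int (degree F1 v) = int (degree F0 v) + unit z (- s) v + unit w t v"
      "t * (int (degree F' w) - int (degree F0 w) - unit z (- s) w) > 0"
      using less.hyps[OF z(4) _ less.prems(2) _ _ over] by blast
    have "F \<inter> F' \<subseteq> F1" "F1 \<subseteq> F \<union> F'" using F1 z by auto
    moreover have "unit z (- s) v = - unit z s v" for v by (simp add: unit_def)
    ultimately show ?thesis using F1 deg0
      by (intro exI[of _ F1] exI[of _ w] exI[of _ t]) (simp add: algebra_simps)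
  qed
qed

text \<open>As \<open>F1\<close> lies between \<open>F \<inter> F'\<close> and \<open>F \<union> F'\<close>, the edges of \<open>F\<close> and \<open>F'\<close> that are not used up by \<open>F1\<close>, with
  multiplicity, form a subgraph \<open>F2\<close>, and it makes the opposite changes to \<open>F'\<close>.\<close>

lemma degree_exchange:
  assumes "simple_graph V E" "F \<subseteq> E" "F' \<subseteq> E" "u \<in> V"
    and "s = 1 \<or> s = -1" "s * (int (degree F' u) - int (degree F u)) > 0"
  obtains F1 F2 w t where "F1 \<subseteq> E" "F2 \<subseteq> E" "w \<in> V" "t = 1 \<or> t = -1"
    "\<And>v. int (degree F1 v) = int (degree F v) + unit u s v + unit w t v"
    "\<And>v. int (degree F2 v) = int (degree F' v) - unit u s v - unit w t v"
    "t * (int (degree F' w) - int (degree F w) - unit u s w) > 0"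
proof -
  have fin: "finite F" "finite F'"
    using assms(2,3) simple_graph_finite_edges[OF assms(1)] finite_subset by auto
  have two: "\<forall>e \<in> F \<union> F'. card e = 2" using assms(1-3) unfolding simple_graph_def by blast
  obtain F1 w t where F1: "F \<inter> F' \<subseteq> F1" "F1 \<subseteq> F \<union> F'" "t = 1 \<or> t = -1"
    and deg: "\<And>v. int (degree F1 v) = int (degree F v) + unit u s v + unit w t v"
    and w: "t * (int (degree F' w) - int (degree F w) - unit u s w) > 0"
    using degree_exchange_one_sided[OF fin two assms(5,6)] by blast
  define F2 where "F2 = (F \<union> F' - F1) \<union> (F \<inter> F')"
  have fin': "finite F1" "finite F2" using F1 fin unfolding F2_def by (auto intro: finite_subset)
  have "F1 \<union> F2 = F \<union> F'" "F1 \<inter> F2 = F \<inter> F'" using F1 unfolding F2_def by auto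
  then have deg': "degree F1 v + degree F2 v = degree F v + degree F' v" for v
    using degree_Un_Int[OF fin'] degree_Un_Int[OF fin] by simp
  have "w \<in> V"
  proof (rule ccontr)
    assume "w \<notin> V"
    then have "{e \<in> F. w \<in> e} = {}" "{e \<in> F'. w \<in> e} = {}" 
      using assms(1-3) unfolding simple_graph_def by blast+
    then have "degree F w = 0" "degree F' w = 0" unfolding degree_def by (simp_all only: card.empty)
    moreover have "w \<noteq> u" using \<open>w \<notin> V\<close> assms(4) by blast
    ultimately show False using w by (simp add: unit_def)
  qed
  show thesis
  proof (rule that[of F1 F2 w t])
    show "F1 \<subseteq> E" "F2 \<subseteq> E" using F1 assms(2,3) unfolding F2_def by auto
    show "int (degree F2 v) = int (degree F' v) - unit u s v - unit w t v" for v
      using deg'[of v] deg[of v] by linarith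
  qed (rule \<open>w \<in> V\<close> F1(3) deg w)+
qed

section \<open>Subgraphs closest to prescribed degrees\<close>

definition deviation :: "'a set \<Rightarrow> ('a \<Rightarrow> int) \<Rightarrow> 'a set set \<Rightarrow> int" where
  "deviation V f F = (\<Sum>v\<in>V. \<bar>int (degree F v) - f v\<bar>)"

definition optimal :: "'a set \<Rightarrow> 'a set set \<Rightarrow> ('a \<Rightarrow> int) \<Rightarrow> 'a set set \<Rightarrow> bool" where
  "optimal V E f F \<longleftrightarrow> F \<subseteq> E \<and> (\<forall>F' \<subseteq> E. deviation V f F \<le> deviation V f F')"

lemma ex_optimal:
  assumes "simple_graph V E" obtains F where "optimal V E f F"
proof -
  have "finite (Pow E)" using simple_graph_finite_edges[OF assms] by simp
  then obtain F where "is_arg_min (deviation V f) (\<lambda>F. F \<in> Pow E) F"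
    using ex_is_arg_min_if_finite[of "Pow E"] by blast
  then show thesis using that unfolding optimal_def is_arg_min_linorder by auto
qed

lemma optimal_if_deviation_le:
  assumes "optimal V E f F" "F' \<subseteq> E" "deviation V f F' \<le> deviation V f F"
  shows "optimal V E f F'"
proof -
  have "deviation V f F' \<le> deviation V f G" if "G \<subseteq> E" for G
    using assms(1,3) that unfolding optimal_def by (meson order_trans)
  then show ?thesis using assms(2) unfolding optimal_def by simp
qed

lemma sum_abs_unit:
  fixes x :: "'a \<Rightarrow> int"
  assumes "finite V" "u \<in> V"
  shows "(\<Sum>v\<in>V. \<bar>x v + unit u s v - f v\<bar>) = (\<Sum>v\<in>V. \<bar>x v - f v\<bar>) + \<bar>x u + s - f u\<bar> - \<bar>x u - f u\<bar>"
proof -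
  have "(\<Sum>v\<in>V - {u}. \<bar>x v + unit u s v - f v\<bar>) = (\<Sum>v\<in>V - {u}. \<bar>x v - f v\<bar>)"
    by (rule sum.cong) (auto simp: unit_def)
  then show ?thesis using assms by (simp add: sum.remove unit_def)
qed

lemma deviation_two_units:
  assumes "simple_graph V E" "u \<in> V" "w \<in> V"
    and "\<And>v. int (degree F1 v) = int (degree F v) + unit u s v + unit w t v"
  shows "deviation V f F1 = deviation V f F + \<bar>int (degree F u) + s - f u\<bar> - \<bar>int (degree F u) - f u\<bar>
    + \<bar>int (degree F w) + unit u s w + t - f w\<bar> - \<bar>int (degree F w) + unit u s w - f w\<bar>"
proof -
  have "finite V" using assms(1) unfolding simple_graph_def by blast
  then show ?thesis unfolding deviation_def assms(4)
    using sum_abs_unit[of V w "\<lambda>v. int (degree F v) + unit u s v" t f]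
      sum_abs_unit[of V u "\<lambda>v. int (degree F v)" s f] assms(2,3) by simp
qed

text \<open>The effect of an exchange at \<open>u\<close> on the deviations. The second step may be at \<open>u\<close> again (case
  \<open>same\<close>). If it is at another vertex \<open>w\<close>, it moves two values at \<open>w\<close> towards each
  other, which by convexity of \<open>\<lambda>x. \<bar>x - f w\<bar>\<close> does not increase the sum of the
  two deviations; only the contributions of \<open>u\<close> need to be recorded.\<close>

lemma exchange_deviation:
  assumes "simple_graph V E" "F \<subseteq> E" "F' \<subseteq> E" "u \<in> V"
    and "s = 1 \<or> s = -1" "s * (int (degree F' u) - int (degree F u)) > 0"
  obtains
    (same) F1 F2 where "F1 \<subseteq> E" "F2 \<subseteq> E" "s * (int (degree F' u) - int (degree F u)) \<ge> 2"
    "\<And>v. int (degree F1 v) = int (degree F v) + unit u (2 * s) v"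
    "\<And>v. int (degree F2 v) = int (degree F' v) - unit u (2 * s) v"
    "deviation V f F1 = deviation V f F + \<bar>int (degree F u) + 2 * s - f u\<bar> - \<bar>int (degree F u) - f u\<bar>"
    "deviation V f F2 = deviation V f F' + \<bar>int (degree F' u) - 2 * s - f u\<bar> - \<bar>int (degree F' u) - f u\<bar>"
  | (other) F1 F2 w t where "F1 \<subseteq> E" "F2 \<subseteq> E" "w \<in> V" "w \<noteq> u"
    "\<And>v. int (degree F1 v) = int (degree F v) + unit u s v + unit w t v"
    "\<And>v. int (degree F2 v) = int (degree F' v) - unit u s v - unit w t v"
    "deviation V f F1 + deviation V f F2 \<le> deviation V f F + deviation V f F'
       + (\<bar>int (degree F u) + s - f u\<bar> - \<bar>int (degree F u) - f u\<bar>)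
       + (\<bar>int (degree F' u) - s - f u\<bar> - \<bar>int (degree F' u) - f u\<bar>)"
proof (rule degree_exchange[OF assms])
  fix F1 F2 w t
  assume F: "F1 \<subseteq> E" "F2 \<subseteq> E" "w \<in> V" and t1: "t = 1 \<or> t = -1"
    and d1: "\<And>v. int (degree F1 v) = int (degree F v) + unit u s v + unit w t v"
    and d2: "\<And>v. int (degree F2 v) = int (degree F' v) - unit u s v - unit w t v"
    and w: "t * (int (degree F' w) - int (degree F w) - unit u s w) > 0"
  have neg: "unit a (- r) v = - unit a r v" for a v :: 'a and r by (simp add: unit_def)
  have dev1: "deviation V f F1 = deviation V f F + \<bar>int (degree F u) + s - f u\<bar> - \<bar>int (degree F u) - f u\<bar>
    + \<bar>int (degree F w) + unit u s w + t - f w\<bar> - \<bar>int (degree F w) + unit u s w - f w\<bar>"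
    by (rule deviation_two_units[OF assms(1,4) F(3) d1])
  have "int (degree F2 v) = int (degree F' v) + unit u (- s) v + unit w (- t) v" for v
    using d2[of v] neg by simp
  from deviation_two_units[OF assms(1,4) F(3) this]
  have dev2: "deviation V f F2 = deviation V f F' + \<bar>int (degree F' u) - s - f u\<bar> - \<bar>int (degree F' u) - f u\<bar>
    + \<bar>int (degree F' w) - unit u s w - t - f w\<bar> - \<bar>int (degree F' w) - unit u s w - f w\<bar>"
    by (simp add: neg)
  show thesis
  proof (cases "w = u")
    case True
    then have at_u: "unit u s w = s" by (simp add: unit_def)
    have t: "t = s" and big: "s * (int (degree F' u) - int (degree F u)) \<ge> 2"
      using w[unfolded at_u] assms(5,6) t1 True by auto
    have two: "unit u (2 * s) v = unit u s v + unit u s v" for v by (simp add: unit_def)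
    show thesis
    proof (rule same[OF F(1,2) big])
      show "int (degree F1 v) = int (degree F v) + unit u (2 * s) v" for v
        using d1[of v] two[of v] t True by simp
      show "int (degree F2 v) = int (degree F' v) - unit u (2 * s) v" for v
        using d2[of v] two[of v] t True by simp
      show "deviation V f F1 = deviation V f F + \<bar>int (degree F u) + 2 * s - f u\<bar> - \<bar>int (degree F u) - f u\<bar>"
        using dev1[unfolded at_u] t True by simp
      show "deviation V f F2 = deviation V f F' + \<bar>int (degree F' u) - 2 * s - f u\<bar> - \<bar>int (degree F' u) - f u\<bar>"
        using dev2[unfolded at_u] t True by simp
    qed
  next
    case False
    then have at_w: "unit u s w = 0" by (simp add: unit_def)
    have le: "\<bar>int (degree F w) + t - f w\<bar> + \<bar>int (degree F' w) - t - f w\<bar>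
      \<le> \<bar>int (degree F w) - f w\<bar> + \<bar>int (degree F' w) - f w\<bar>"
      using w[unfolded at_w] t1 by auto
    have arith: "x + x' \<le> y + y' + (p - q) + (p' - q')"
      if "x = y + p - q + c - e" "x' = y' + p' - q' + c' - e'" "c + c' \<le> e + e'"
      for x x' y y' p p' q q' c c' e e' :: int
      using that by linarith
    show thesis
      by (rule other[OF F(1,2,3) False d1 d2],
          rule arith[OF dev1[unfolded at_w add_0_right] dev2[unfolded at_w diff_zero] le])
  qed
qed


section \<open>Graphs in which every vertex can miss its target on both sides or on none\<close>

definition balanced :: "'a set \<Rightarrow> 'a set set \<Rightarrow> ('a \<Rightarrow> int) \<Rightarrow> bool" where
  "balanced V E f \<longleftrightarrow> (\<forall>v\<in>V. (\<exists>F. optimal V E f F \<and> int (degree F v) < f v) \<longleftrightarrow>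
     (\<exists>F. optimal V E f F \<and> int (degree F v) > f v))"

text \<open>By balancedness another optimal subgraph misses the target at \<open>u\<close> on the other side. Exchanging
  at \<open>u\<close> towards it would improve the sum of both deviations, unless the
  second step is at \<open>u\<close> too and merely reflects a deviation of \<open>1\<close>. Hence all deviations are \<open>1\<close>, and
  their signs can be chosen at will.\<close>

lemma balanced_flip:
  assumes G: "simple_graph V E" and bal: "balanced V E f" and opt: "optimal V E f F"
    and u: "u \<in> V" "int (degree F u) \<noteq> f u"
  obtains F' s where "optimal V E f F'" "s = 1 \<or> s = -1" "f u = int (degree F u) + s"
    "\<And>v. int (degree F' v) = int (degree F v) + unit u (2 * s) v"
proof -
  define s :: int where "s = (if int (degree F u) < f u then 1 else -1)"
  have s: "s = 1 \<or> s = -1" by (simp add: s_def)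
  obtain F'' where opt'': "optimal V E f F''" "s * (int (degree F'' u) - f u) > 0"
  proof (cases "int (degree F u) < f u")
    case True
    then obtain F'' where "optimal V E f F''" "int (degree F'' u) > f u"
      using bal opt u(1) unfolding balanced_def by meson
    then show thesis using that[of F''] True by (simp add: s_def)
  next
    case False
    then have "f u < int (degree F u)" using u(2) by simp
    then obtain F'' where "optimal V E f F''" "int (degree F'' u) < f u"
      using bal opt u(1) unfolding balanced_def by meson
    then show thesis using that[of F''] False by (simp add: s_def)
  qed
  have sub: "F \<subseteq> E" "F'' \<subseteq> E" using opt opt'' unfolding optimal_def by auto
  have x: "s * (f u - int (degree F u)) > 0" using u(2) by (simp add: s_def)
  have lt: "s * (int (degree F'' u) - int (degree F u)) > 0"
    using x opt''(2) s by auto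
  have min: "deviation V f F \<le> deviation V f H" if "H \<subseteq> E" for H
    using opt that unfolding optimal_def by blast
  have eq: "deviation V f F'' = deviation V f F"
    using opt opt''(1) sub unfolding optimal_def by (meson order_antisym)
  show thesis
  proof (rule exchange_deviation[OF G sub u(1) s lt])
    fix F1 F2
    assume F1: "F1 \<subseteq> E" and deg: "\<And>v. int (degree F1 v) = int (degree F v) + unit u (2 * s) v"
      and dev: "deviation V f F1 = deviation V f F + \<bar>int (degree F u) + 2 * s - f u\<bar> - \<bar>int (degree F u) - f u\<bar>"
    have "\<bar>int (degree F u) - f u\<bar> \<le> \<bar>int (degree F u) + 2 * s - f u\<bar>"
      using dev min[OF F1] by simp
    then have fu: "f u = int (degree F u) + s" using x s by auto
    then have "deviation V f F1 = deviation V f F" using dev s by auto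
    then have "optimal V E f F1" using optimal_if_deviation_le[OF opt F1] by simp
    then show thesis using that s fu deg by blast
  next
    fix F1 F2 w t
    assume F: "F1 \<subseteq> E" "F2 \<subseteq> E"
      and dev: "deviation V f F1 + deviation V f F2 \<le> deviation V f F + deviation V f F''
       + (\<bar>int (degree F u) + s - f u\<bar> - \<bar>int (degree F u) - f u\<bar>)
       + (\<bar>int (degree F'' u) - s - f u\<bar> - \<bar>int (degree F'' u) - f u\<bar>)"
    have "\<bar>int (degree F u) + s - f u\<bar> = \<bar>int (degree F u) - f u\<bar> - 1"
      "\<bar>int (degree F'' u) - s - f u\<bar> = \<bar>int (degree F'' u) - f u\<bar> - 1"
      using x opt''(2) s by auto
    then show thesis using dev eq min[OF F(1)] min[OF F(2)] by simp
  qed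
qed

lemma balanced_choose_side:
  assumes "simple_graph V E" "balanced V E f" "optimal V E f F"
    and "u \<in> V" "int (degree F u) \<noteq> f u" and s: "s = 1 \<or> s = -1"
  obtains F' where "optimal V E f F'" "int (degree F' u) = f u + s"
    "\<And>v. v \<noteq> u \<Longrightarrow> degree F' v = degree F v"
proof -
  obtain F' t where F': "optimal V E f F'" "t = 1 \<or> t = -1" "f u = int (degree F u) + t"
    "\<And>v. int (degree F' v) = int (degree F v) + unit u (2 * t) v"
    by (rule balanced_flip[OF assms(1-5)]) blast
  show thesis
  proof (cases "s = t")
    case True
    show thesis
    proof (rule that[OF F'(1)])
      show "int (degree F' u) = f u + s" using F'(3) F'(4)[of u] True by (simp add: unit_def)
      show "degree F' v = degree F v" if "v \<noteq> u" for v using F'(4)[of v] that by (simp add: unit_def)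
    qed
  next
    case False
    then have "s = - t" using s F'(2) by auto
    then show thesis using that[OF assms(3)] F'(3) by simp
  qed
qed

lemma toggle_edge:
  assumes G: "simple_graph V E" and "F \<subseteq> E" "{u, v} \<in> E"
    and s: "s = (if {u, v} \<in> F then -1 else 1)"
  obtains F' where "F' \<subseteq> E" "\<And>x. int (degree F' x) = int (degree F x) + unit u s x + unit v s x"
    "deviation V f F' = deviation V f F + \<bar>int (degree F u) + s - f u\<bar> - \<bar>int (degree F u) - f u\<bar>
       + \<bar>int (degree F v) + s - f v\<bar> - \<bar>int (degree F v) - f v\<bar>"
proof -
  note uv = simple_graph_edge_ends_differ[OF G assms(3)]
  have fin: "finite F" using assms(2) simple_graph_finite_edges[OF G] finite_subset by blast
  define F' where "F' = (if {u, v} \<in> F then F - {{u, v}} else insert {u, v} F)"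
  have sub: "F' \<subseteq> E" using assms(2,3) unfolding F'_def by auto
  have deg: "int (degree F' x) = int (degree F x) + unit u s x + unit v s x" for x
    using degree_insert_unit[OF fin _ uv(1)] degree_remove_unit[OF fin _ uv(1)]
    unfolding F'_def s by simp
  have "unit u s v = 0" using uv(1) by (simp add: unit_def)
  then show thesis using that[OF sub deg] deviation_two_units[OF G uv(2,3) deg, of f] by simp
qed

text \<open>Were both ends of an edge off target, their signs could be made opposite. Switching the edge
  then corrects one end and leaves the other one with a deviation of \<open>2\<close>, without any change of the
  total; but a deviation of \<open>2\<close> contradicts \<open>balanced_flip\<close>.\<close>

lemma balanced_adjacent:
  assumes G: "simple_graph V E" and bal: "balanced V E f" and opt: "optimal V E f F"
    and e: "{u, v} \<in> E" and u: "int (degree F u) \<noteq> f u"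
  shows "int (degree F v) = f v"
proof (rule ccontr)
  assume v: "int (degree F v) \<noteq> f v"
  note uv = simple_graph_edge_ends_differ[OF G e]
  obtain F1 where F1: "optimal V E f F1" "int (degree F1 u) = f u + 1" "degree F1 v = degree F v"
    by (rule balanced_choose_side[OF G bal opt uv(2) u, of 1]) (use uv(1) in auto)
  have "int (degree F1 v) \<noteq> f v" using F1(3) v by simp
  then obtain F2 where F2: "optimal V E f F2" "int (degree F2 v) = f v - 1" "degree F2 u = degree F1 u"
    using balanced_choose_side[OF G bal F1(1) uv(3), of "-1"] uv(1) by auto
  define s :: int where "s = (if {u, v} \<in> F2 then -1 else 1)"
  have "F2 \<subseteq> E" using F2(1) unfolding optimal_def by blast
  then obtain F3 where F3: "F3 \<subseteq> E"
    and deg: "\<And>x. int (degree F3 x) = int (degree F2 x) + unit u s x + unit v s x"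
    and dev: "deviation V f F3 = deviation V f F2 + \<bar>int (degree F2 u) + s - f u\<bar> - \<bar>int (degree F2 u) - f u\<bar>
       + \<bar>int (degree F2 v) + s - f v\<bar> - \<bar>int (degree F2 v) - f v\<bar>"
    using toggle_edge[OF G _ e s_def, of f] by metis
  have F2u: "int (degree F2 u) = f u + 1" using F1(2) F2(3) by simp
  have s: "s = 1 \<or> s = -1" by (simp add: s_def)
  then have "deviation V f F3 = deviation V f F2" using dev F2u F2(2) by auto
  then have opt3: "optimal V E f F3" using optimal_if_deviation_le[OF F2(1) F3] by simp
  define y where "y = (if s = 1 then u else v)"
  have y: "y \<in> V" "\<bar>int (degree F3 y) - f y\<bar> = 2"
    using s deg[of u] deg[of v] uv F2u F2(2) unfolding y_def by (auto simp: unit_def)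
  then have "int (degree F3 y) \<noteq> f y" by auto
  then show False
    by (rule balanced_flip[OF G bal opt3 y(1)]) (use y(2) in auto)
qed

definition critical :: "'a set \<Rightarrow> 'a set set \<Rightarrow> ('a \<Rightarrow> int) \<Rightarrow> 'a \<Rightarrow> bool" where
  "critical V E f v \<longleftrightarrow> (\<exists>F. optimal V E f F \<and> int (degree F v) \<noteq> f v)"

text \<open>Suppose that \<open>v\<close> is always on target. Let \<open>F\<close> be optimal and one below the target at \<open>u\<close>, and let \<open>F'\<close>
  be its reflection, which is one above. The edge lies in \<open>F\<close>, as otherwise adding it would move the
  error from \<open>u\<close> to \<open>v\<close>. The degrees of \<open>F\<close> without the edge and of \<open>F'\<close> differ only by \<open>3\<close> at \<open>u\<close> and \<open>1\<close>
  at \<open>v\<close>, so an exchange at \<open>v\<close> has its second step at \<open>u\<close>. On the side of \<open>F'\<close> it moves the error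
  from \<open>u\<close> to \<open>v\<close> after all.\<close>

lemma balanced_critical_neighbour:
  assumes G: "simple_graph V E" and bal: "balanced V E f"
    and e: "{u, v} \<in> E" and crit: "critical V E f u"
  shows "critical V E f v"
proof (rule ccontr)
  assume "\<not> ?thesis"
  then have tight: "int (degree F v) = f v" if "optimal V E f F" for F
    using that unfolding critical_def by blast
  note uv = simple_graph_edge_ends_differ[OF G e]
  from crit obtain F0 where F0: "optimal V E f F0" "int (degree F0 u) \<noteq> f u"
    unfolding critical_def by blast
  obtain F where F: "optimal V E f F" "int (degree F u) = f u - 1"
    using balanced_choose_side[OF G bal F0(1) uv(2) F0(2), of "-1"] by auto
  then have "int (degree F u) \<noteq> f u" by simp
  then obtain F' t where F': "optimal V E f F'" "f u = int (degree F u) + t"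
    "\<And>v. int (degree F' v) = int (degree F v) + unit u (2 * t) v"
    using balanced_flip[OF G bal F(1) uv(2)] by metis
  have deg': "int (degree F' x) = int (degree F x) + unit u 2 x" for x
    using F'(2,3) F(2) by simp
  have sub: "F \<subseteq> E" "F' \<subseteq> E" using F(1) F'(1) unfolding optimal_def by auto
  define s :: int where "s = (if {u, v} \<in> F then -1 else 1)"
  obtain H where H: "H \<subseteq> E"
    and degH: "\<And>x. int (degree H x) = int (degree F x) + unit u s x + unit v s x"
    and dev: "deviation V f H = deviation V f F + \<bar>int (degree F u) + s - f u\<bar> - \<bar>int (degree F u) - f u\<bar>
       + \<bar>int (degree F v) + s - f v\<bar> - \<bar>int (degree F v) - f v\<bar>"
    using toggle_edge[OF G sub(1) e s_def, of f] by metis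
  have Hv: "int (degree H v) = f v + s" using degH[of v] tight[OF F(1)] uv by (simp add: unit_def)
  have "s = -1"
  proof (rule ccontr)
    assume "s \<noteq> -1"
    then have s: "s = 1" by (simp add: s_def split: if_splits)
    then have "deviation V f H = deviation V f F" using dev F(2) tight[OF F(1)] by simp
    then have "optimal V E f H" using optimal_if_deviation_le[OF F(1) H] by simp
    then show False using tight Hv s by simp
  qed
  have lt: "1 * (int (degree F' v) - int (degree H v)) > 0"
    using tight[OF F'(1)] Hv \<open>s = -1\<close> by simp
  have diff: "int (degree F' x) - int (degree H x) = unit u 3 x + unit v 1 x" for x
    using deg'[of x] degH[of x] \<open>s = -1\<close> by (simp add: unit_def)
  obtain F1 F2 w t where F2: "F2 \<subseteq> E" "w \<in> V" "t = 1 \<or> t = -1"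
    and degF2: "\<And>x. int (degree F2 x) = int (degree F' x) - unit v 1 x - unit w t x"
    and w: "t * (int (degree F' w) - int (degree H w) - unit v 1 w) > 0"
    using degree_exchange[OF G H sub(2) uv(3) _ lt] by metis
  have "t * unit u 3 w > 0" using w diff[of w] by simp
  then have wt: "w = u" "t = 1" using F2(3) by (auto simp: unit_def split: if_splits)
  have degF2': "int (degree F2 x) = int (degree F' x) + unit v (-1) x + unit u (-1) x" for x
    using degF2[of x] wt by (simp add: unit_def)
  have "deviation V f F2 = deviation V f F'"
    using deviation_two_units[OF G uv(3,2) degF2', of f] deg'[of u] F(2) tight[OF F'(1)] uv(1)
    by (simp add: unit_def)
  then have "optimal V E f F2" using optimal_if_deviation_le[OF F'(1) F2(1)] by simp
  moreover have "int (degree F2 v) \<noteq> f v" using degF2'[of v] tight[OF F'(1)] uv(1) by (simp add: unit_def)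
  ultimately show False using tight by blast
qed

text \<open>The counterpart of the exchange step in the proof of Gallai's lemma. An exchange at \<open>t\<close> towards
  an optimal subgraph that is off target at \<open>t\<close> again gives an optimal subgraph. It is off target at \<open>t\<close>, and its
  only other change is at a single vertex, so at least one of \<open>u\<close> and \<open>w\<close> remains off target.\<close>

lemma deviating_pair_transfer:
  assumes G: "simple_graph V E"
    and opt: "optimal V E f F" "int (degree F u) \<noteq> f u" "int (degree F w) \<noteq> f w" "u \<noteq> w"
    and t: "t \<in> V" "t \<noteq> u" "t \<noteq> w" "critical V E f t"
  shows "\<exists>F'. optimal V E f F' \<and> int (degree F' t) \<noteq> f t \<and>
    (int (degree F' u) \<noteq> f u \<or> int (degree F' w) \<noteq> f w)"
proof (cases "int (degree F t) = f t")
  case False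
  then show ?thesis using opt by blast
next
  case Ft: True
  from t(4) obtain Y where Y: "optimal V E f Y" "int (degree Y t) \<noteq> f t"
    unfolding critical_def by blast
  have sub: "F \<subseteq> E" "Y \<subseteq> E" using opt(1) Y(1) unfolding optimal_def by auto
  have min: "deviation V f F \<le> deviation V f H" if "H \<subseteq> E" for H
    using opt that unfolding optimal_def by blast
  have eq: "deviation V f Y = deviation V f F"
    using opt(1) Y(1) sub unfolding optimal_def by (meson order_antisym)
  define s :: int where "s = (if int (degree Y t) < f t then -1 else 1)"
  have s: "s = 1 \<or> s = -1" by (simp add: s_def)
  have lt: "s * (int (degree Y t) - int (degree F t)) > 0" using Ft Y(2) by (simp add: s_def)
  show ?thesis
  proof (rule exchange_deviation[OF G sub t(1) s lt])
    fix F1 F2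
    assume big: "s * (int (degree Y t) - int (degree F t)) \<ge> 2"
      and F: "F1 \<subseteq> E" "F2 \<subseteq> E"
      and deg: "\<And>v. int (degree F1 v) = int (degree F v) + unit t (2 * s) v"
      and dev: "deviation V f F1 = deviation V f F + \<bar>int (degree F t) + 2 * s - f t\<bar> - \<bar>int (degree F t) - f t\<bar>"
        "deviation V f F2 = deviation V f Y + \<bar>int (degree Y t) - 2 * s - f t\<bar> - \<bar>int (degree Y t) - f t\<bar>"
    have "deviation V f F2 \<le> deviation V f F - 2" using dev(2) big Ft s eq by auto
    then show ?thesis using min[OF F(2)] by simp
  next
    fix F1 F2 x r
    assume F: "F1 \<subseteq> E" "F2 \<subseteq> E" and x: "x \<noteq> t"
      and deg: "\<And>v. int (degree F1 v) = int (degree F v) + unit t s v + unit x r v"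
      and dev: "deviation V f F1 + deviation V f F2 \<le> deviation V f F + deviation V f Y
       + (\<bar>int (degree F t) + s - f t\<bar> - \<bar>int (degree F t) - f t\<bar>)
       + (\<bar>int (degree Y t) - s - f t\<bar> - \<bar>int (degree Y t) - f t\<bar>)"
    have "\<bar>int (degree F t) + s - f t\<bar> - \<bar>int (degree F t) - f t\<bar> = 1" using Ft s by auto
    moreover have "\<bar>int (degree Y t) - s - f t\<bar> - \<bar>int (degree Y t) - f t\<bar> = - 1"
      using lt Ft s by auto
    ultimately have "deviation V f F1 \<le> deviation V f F" using dev eq min[OF F(2)] by simp
    then have "optimal V E f F1" using optimal_if_deviation_le[OF opt(1) F(1)] by simp
    moreover have "int (degree F1 t) \<noteq> f t" using deg[of t] x Ft s by (auto simp: unit_def)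
    moreover have "x \<noteq> u \<or> x \<noteq> w" using opt(4) by blast
    then have "int (degree F1 u) \<noteq> f u \<or> int (degree F1 w) \<noteq> f w"
      using deg[of u] deg[of w] t(2,3) opt(2,3) by (auto simp: unit_def)
    ultimately show ?thesis by blast
  qed
qed


section \<open>Barriers\<close>

text \<open>The labels stand for the pieces of the graph without \<open>S\<close> and \<open>T\<close>; a piece may be a union of several
  components.\<close>

definition separation :: "'a set \<Rightarrow> 'a set set \<Rightarrow> 'a set \<Rightarrow> 'a set \<Rightarrow> ('a \<Rightarrow> 'b) \<Rightarrow> bool" where
  "separation V E S T c \<longleftrightarrow> S \<subseteq> V \<and> T \<subseteq> V \<and> S \<inter> T = {} \<and>
     (\<forall>x \<in> V - S - T. \<forall>y \<in> V - S - T. {x, y} \<in> E \<longrightarrow> c x = c y)"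

text \<open>Summed over a piece, this has the parity that decides whether the piece is odd. For constant
  \<open>f = k\<close> it is \<open>k\<close> times the size of the piece plus the number of edges from the piece to \<open>T\<close>.\<close>

definition charge :: "'a set set \<Rightarrow> ('a \<Rightarrow> int) \<Rightarrow> 'a set \<Rightarrow> 'a \<Rightarrow> int" where
  "charge E f T u = f u + int (card (neighbours E u \<inter> T))"

definition odd_labels ::
  "'a set \<Rightarrow> 'a set set \<Rightarrow> ('a \<Rightarrow> int) \<Rightarrow> 'a set \<Rightarrow> 'a set \<Rightarrow> ('a \<Rightarrow> 'b) \<Rightarrow> 'b set" where
  "odd_labels V E f S T c = {l. odd (\<Sum>u \<in> {u \<in> V - S - T. c u = l}. charge E f T u)}"

text \<open>The expression of the theorem of Belck and Tutte, for targets that depend on the vertex.\<close>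

definition surplus ::
  "'a set \<Rightarrow> 'a set set \<Rightarrow> ('a \<Rightarrow> int) \<Rightarrow> 'a set \<Rightarrow> 'a set \<Rightarrow> ('a \<Rightarrow> 'b) \<Rightarrow> int" where
  "surplus V E f S T c = (\<Sum>v\<in>S. f v) - (\<Sum>v\<in>T. f v)
     + (\<Sum>t\<in>T. int (card (neighbours E t - S))) - int (card (odd_labels V E f S T c))"

lemma odd_labels_subset: "odd_labels V E f S T c \<subseteq> c ` (V - S - T)"
proof
  fix l assume l: "l \<in> odd_labels V E f S T c"
  have "{u \<in> V - S - T. c u = l} \<noteq> {}"
  proof
    assume "{u \<in> V - S - T. c u = l} = {}"
    then show False using l unfolding odd_labels_def by (simp only: mem_Collect_eq sum.empty) simp
  qed
  then show "l \<in> c ` (V - S - T)" by blast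
qed

lemma finite_odd_labels: "finite V \<Longrightarrow> finite (odd_labels V E f S T c)"
  using odd_labels_subset by (metis finite_Diff finite_imageI finite_subset)

text \<open>Both sides count the pairs of adjacent vertices \<open>x \<in> A\<close>, \<open>y \<in> B\<close>.\<close>

lemma sum_card_neighbours_swap:
  assumes "finite A" "finite B"
  shows "(\<Sum>x\<in>A. int (card (neighbours E x \<inter> B))) = (\<Sum>y\<in>B. int (card (neighbours E y \<inter> A)))"
proof -
  have count: "int (card (neighbours E x \<inter> C)) = (\<Sum>y\<in>C. of_bool (y \<in> neighbours E x))"
    if "finite C" for x C
    using that by (simp add: Int_commute)
  have "(\<Sum>x\<in>A. int (card (neighbours E x \<inter> B))) = (\<Sum>x\<in>A. \<Sum>y\<in>B. of_bool (y \<in> neighbours E x))"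
    by (simp only: count[OF assms(2)])
  also have "\<dots> = (\<Sum>y\<in>B. \<Sum>x\<in>A. of_bool (y \<in> neighbours E x))" by (rule sum.swap)
  also have "\<dots> = (\<Sum>y\<in>B. \<Sum>x\<in>A. of_bool (x \<in> neighbours E y))" by (simp only: neighbours_sym)
  also have "\<dots> = (\<Sum>y\<in>B. int (card (neighbours E y \<inter> A)))" by (simp only: count[OF assms(1)])
  finally show ?thesis .
qed

lemma even_sum_inner_degree:
  assumes "simple_graph V E" "K \<subseteq> V"
  shows "even (\<Sum>v\<in>K. int (card (neighbours E v \<inter> K)))"
proof -
  define E' where "E' = {e \<in> E. e \<subseteq> K}"
  have G: "simple_graph K E'"
    using assms finite_subset unfolding simple_graph_def E'_def by blast
  have "even (\<Sum>v\<in>K. degree E' v)"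
    by (rule even_sum_degree[OF G]) (auto simp: E'_def)
  moreover have "degree E' v = card (neighbours E v \<inter> K)" if "v \<in> K" for v
  proof -
    have "neighbours E' v = neighbours E v \<inter> K" using that unfolding neighbours_def E'_def by auto
    then show ?thesis using degree_eq_card_neighbours[OF G] by metis
  qed
  ultimately have "even (\<Sum>v\<in>K. card (neighbours E v \<inter> K))" by (metis (no_types, lifting) sum.cong)
  then have "even (int (\<Sum>v\<in>K. card (neighbours E v \<inter> K)))" by (simp only: even_of_nat_iff)
  then show ?thesis by (simp only: of_nat_sum)
qed

lemma card_neighbours_split:
  assumes "simple_graph V E" "S \<inter> T = {}" "S \<subseteq> V" "T \<subseteq> V"
  shows "card (neighbours E v) = card (neighbours E v \<inter> S) + card (neighbours E v - S)"
    and "card (neighbours E v - S) = card (neighbours E v \<inter> T) + card (neighbours E v \<inter> (V - S - T))"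
proof -
  note N = neighbours_in[OF assms(1), of v]
  show "card (neighbours E v) = card (neighbours E v \<inter> S) + card (neighbours E v - S)"
    using card_Int_Diff[OF N(2)] by blast
  have "(neighbours E v - S) \<inter> T = neighbours E v \<inter> T" using assms(2) by blast
  moreover have "(neighbours E v - S) - T = neighbours E v \<inter> (V - S - T)" using N(1) by blast
  ultimately show "card (neighbours E v - S) = card (neighbours E v \<inter> T) + card (neighbours E v \<inter> (V - S - T))"
    using card_Int_Diff[of "neighbours E v - S" T] N(2) by simp
qed

text \<open>The number of odd pieces has the parity of the total charge outside \<open>S\<close> and \<open>T\<close>, that is, of the
  targets there plus the number of edges to \<open>T\<close>. These edges are counted by \<open>d_{G-S}\<close> on \<open>T\<close> as well,
  together with twice the edges inside \<open>T\<close>.\<close>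

lemma surplus_parity:
  assumes G: "simple_graph V E" and sep: "separation V E S T c"
  shows "even (surplus V E f S T c + (\<Sum>v\<in>V. f v))"
proof -
  define U where "U = V - S - T"
  have sub: "S \<subseteq> V" "T \<subseteq> V" "S \<inter> T = {}" using sep unfolding separation_def by auto
  have fin: "finite V" "finite S" "finite T" "finite U"
    using G sub finite_subset unfolding simple_graph_def U_def by auto
  define x where "x l = (\<Sum>u \<in> {u \<in> U. c u = l}. charge E f T u)" for l
  have "odd_labels V E f S T c = {l \<in> c ` U. odd (x l)}"
    using odd_labels_subset[of V E f S T c] unfolding odd_labels_def x_def U_def by blast
  then have "even (card (odd_labels V E f S T c)) \<longleftrightarrow> even (\<Sum>l \<in> c ` U. x l)"
    using even_sum_iff[of "c ` U" x] fin(4) by simp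
  also have "(\<Sum>l \<in> c ` U. x l) = (\<Sum>u\<in>U. charge E f T u)"
    unfolding x_def by (rule sum.image_gen[OF fin(4), symmetric])
  also have "\<dots> = (\<Sum>u\<in>U. f u) + (\<Sum>t\<in>T. int (card (neighbours E t \<inter> U)))"
    unfolding charge_def sum.distrib by (simp only: sum_card_neighbours_swap[OF fin(4,3)])
  finally have q: "even (card (odd_labels V E f S T c)) \<longleftrightarrow>
    even ((\<Sum>u\<in>U. f u) + (\<Sum>t\<in>T. int (card (neighbours E t \<inter> U))))" .
  have X: "(\<Sum>t\<in>T. int (card (neighbours E t - S))) =
    (\<Sum>t\<in>T. int (card (neighbours E t \<inter> T))) + (\<Sum>t\<in>T. int (card (neighbours E t \<inter> U)))"
    unfolding sum.distrib[symmetric] U_def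
    by (rule sum.cong) (simp_all add: card_neighbours_split(2)[OF G sub(3,1,2)])
  have "T \<subseteq> V - S" using sub by blast
  then have V: "(\<Sum>v\<in>V. f v) = (\<Sum>v\<in>S. f v) + (\<Sum>v\<in>T. f v) + (\<Sum>v\<in>U. f v)"
    using sum.subset_diff[OF sub(1) fin(1), of f] sum.subset_diff[of T "V - S" f] fin(1)
    unfolding U_def by simp
  have "even (int (card (odd_labels V E f S T c)) + (\<Sum>u\<in>U. f u) + (\<Sum>t\<in>T. int (card (neighbours E t \<inter> U))))"
    using q unfolding even_add even_of_nat_iff by blast
  then show ?thesis
    using even_sum_inner_degree[OF G sub(2)] unfolding surplus_def X V by presburger
qed

text \<open>The nontrivial direction of the duality: some subgraph \<open>F\<close> and some barrier certify that the
  minimum deviation is at most the maximum of \<open>- surplus\<close>. Sets of vertices serve as labels because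
  the labels of the basic construction are equivalence classes.\<close>

definition certified :: "'a set \<Rightarrow> 'a set set \<Rightarrow> ('a \<Rightarrow> int) \<Rightarrow> bool" where
  "certified V E f \<longleftrightarrow> (\<exists>F S T. \<exists>c :: 'a \<Rightarrow> 'a set. F \<subseteq> E \<and> separation V E S T c \<and>
     surplus V E f S T c \<le> - deviation V f F)"

section \<open>The min-max theorem for prescribed degrees\<close>

text \<open>With \<open>S = T = {}\<close>, the label of a critical vertex is its class under ``equal, or never both off target'',
  and all other vertices share the label \<open>{}\<close>. An optimal subgraph \<open>F\<close> is off target at no more than one
  vertex of each class, and there by \<open>1\<close>. Since the degrees of \<open>F\<close> within a class have an even sum, the sum of the
  targets is odd on each class with such a vertex. So there are at least as many odd classes as the
  deviation of \<open>F\<close>.\<close>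

lemma certified_if_balanced:
  assumes G: "simple_graph V E" and bal: "balanced V E f"
  shows "certified V E f"
proof -
  have finV: "finite V" using G unfolding simple_graph_def by blast
  obtain F where opt: "optimal V E f F" by (rule ex_optimal[OF G])
  then have sub: "F \<subseteq> E" unfolding optimal_def by blast
  define R where "R x y \<longleftrightarrow> x = y \<or>
    \<not> (\<exists>F. optimal V E f F \<and> int (degree F x) \<noteq> f x \<and> int (degree F y) \<noteq> f y)" for x y
  define c where "c v = (if critical V E f v then {w \<in> V. critical V E f w \<and> R v w} else {})" for v
  have R_sym: "R x y \<Longrightarrow> R y x" for x y unfolding R_def by blast
  have R_trans: "R y w" if "R x y" "R x w" "x \<in> V" "critical V E f x" for x y w
  proof (rule ccontr)
    assume "\<not> R y w"
    then obtain F' where F': "optimal V E f F'" "int (degree F' y) \<noteq> f y" "int (degree F' w) \<noteq> f w" "y \<noteq> w"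
      unfolding R_def by blast
    have "x \<noteq> y" "x \<noteq> w" using that F' unfolding R_def by metis+
    then show False
      using deviating_pair_transfer[OF G F' that(3) _ _ that(4)] that(1,2) unfolding R_def by blast
  qed
  have c_eq: "c x = c y" if "{x, y} \<in> E" for x y
  proof (cases "critical V E f x")
    case True
    then have y: "critical V E f y" using balanced_critical_neighbour[OF G bal that] by blast
    have xy: "x \<in> V" "y \<in> V" using simple_graph_edge_ends_differ[OF G that] by auto
    have "R x y" unfolding R_def using balanced_adjacent[OF G bal _ that] by blast
    then have "R x w \<longleftrightarrow> R y w" for w using R_trans R_sym True y xy by blast
    then show ?thesis using True y unfolding c_def by simp
  next
    case False
    have "{y, x} \<in> E" using that by (simp add: insert_commute)
    then have "\<not> critical V E f y" using balanced_critical_neighbour[OF G bal] False by blast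
    then show ?thesis using False unfolding c_def by simp
  qed
  define D where "D = {v \<in> V. int (degree F v) \<noteq> f v}"
  have one: "\<bar>int (degree F v) - f v\<bar> = 1" if "v \<in> D" for v
  proof -
    have "v \<in> V" "int (degree F v) \<noteq> f v" using that unfolding D_def by auto
    then show ?thesis by (rule balanced_flip[OF G bal opt]) auto
  qed
  have "deviation V f F = (\<Sum>v\<in>V. of_bool (v \<in> D))"
    unfolding deviation_def by (rule sum.cong) (use one in \<open>auto simp: D_def\<close>)
  also have "\<dots> = int (card D)" using finV by (simp add: D_def Int_def)
  finally have dev: "deviation V f F = int (card D)" .
  have apart: "v = w" if "v \<in> D" "w \<in> V" "c v = c w" "int (degree F w) \<noteq> f w" for v w
  proof -
    have crit: "critical V E f v" "critical V E f w"
      using that opt unfolding D_def critical_def by blast+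
    have "w \<in> c w" using that(2) crit unfolding c_def R_def by simp
    then have "w \<in> c v" using that(3) by simp
    then have "R v w" using crit unfolding c_def by simp
    then show ?thesis using that opt unfolding R_def D_def by blast
  qed
  have "inj_on c D" by (rule inj_onI) (use apart in \<open>auto simp: D_def\<close>)
  moreover have "c ` D \<subseteq> odd_labels V E f {} {} c"
  proof
    fix l assume "l \<in> c ` D"
    then obtain v where v: "v \<in> D" "l = c v" by blast
    define K where "K = {u \<in> V. c u = l}"
    have K: "finite K" "v \<in> K" "K \<subseteq> V" using finV v unfolding K_def D_def by auto
    have "even (\<Sum>u\<in>K. degree F u)"
    proof (rule even_sum_degree[OF G sub K(3)])
      fix x y assume "{x, y} \<in> E" "x \<in> K"
      then show "y \<in> K" using c_eq simple_graph_edge_ends_differ[OF G] unfolding K_def by auto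
    qed
    then have "even (int (\<Sum>u\<in>K. degree F u))" by (simp only: even_of_nat_iff)
    then have ev: "even (\<Sum>u\<in>K. int (degree F u))" by (simp only: of_nat_sum)
    have "(\<Sum>u\<in>K - {v}. f u) = (\<Sum>u\<in>K - {v}. int (degree F u))"
    proof (rule sum.cong)
      fix u assume "u \<in> K - {v}"
      then have u: "u \<in> V" "c v = c u" "u \<noteq> v" using v(2) unfolding K_def by auto
      then show "f u = int (degree F u)" using apart[OF v(1) u(1,2)] by metis
    qed simp
    then have "(\<Sum>u\<in>K. int (degree F u)) - (\<Sum>u\<in>K. f u) = int (degree F v) - f v"
      using K by (simp add: sum.remove)
    moreover have "odd (int (degree F v) - f v)" using one[OF v(1)] by presburger
    ultimately have "odd (\<Sum>u\<in>K. f u)" using ev by presburger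
    then show "l \<in> odd_labels V E f {} {} c" unfolding odd_labels_def charge_def K_def by simp
  qed
  ultimately have "card D \<le> card (odd_labels V E f {} {} c)"
    by (rule card_inj_on_le[OF _ _ finite_odd_labels[OF finV]])
  then have "surplus V E f {} {} c \<le> - deviation V f F" unfolding surplus_def dev by simp
  moreover have "separation V E {} {} c" unfolding separation_def using c_eq by simp
  ultimately show ?thesis unfolding certified_def using sub by blast
qed

text \<open>Forcing the degree at \<open>v\<close> below the target by \<open>j\<close> costs \<open>j\<close> at \<open>v\<close> itself and \<open>j\<close> more at other
  vertices. An exchange at \<open>v\<close> between \<open>F\<close> and \<open>Y\<close> reduces both deviations at \<open>v\<close>, so that the cost for \<open>j\<close>
  exceeds the one for \<open>j - 1\<close> by at least \<open>2\<close>; if both steps are at \<open>v\<close>, then \<open>Y\<close> would become better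
  or an optimal subgraph below the target.\<close>

lemma excess_vertex_bound:
  assumes G: "simple_graph V E" and v: "v \<in> V"
    and above: "optimal V E f Y" "int (degree Y v) > f v"
    and not_below: "\<And>F. optimal V E f F \<Longrightarrow> int (degree F v) \<ge> f v"
    and F: "F \<subseteq> E" "int (degree F v) \<le> f v"
  shows "deviation V f F \<ge> deviation V f Y + 2 * (f v - int (degree F v))"
  using F
proof (induction "nat (f v - int (degree F v))" arbitrary: F rule: less_induct)
  case less
  have min: "deviation V f Y \<le> deviation V f H" if "H \<subseteq> E" for H
    using above(1) that unfolding optimal_def by blast
  have Y: "Y \<subseteq> E" using above(1) unfolding optimal_def by blast
  show ?case
  proof (cases "int (degree F v) = f v")
    case True
    then show ?thesis using min less.prems by simp
  next
    case False
    then have lt: "int (degree F v) < f v" using less.prems by simp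
    then have lt': "1 * (int (degree Y v) - int (degree F v)) > 0" using above(2) by simp
    show ?thesis
    proof (rule exchange_deviation[OF G less.prems(1) Y v _ lt'])
      show "(1::int) = 1 \<or> (1::int) = - 1" by simp
    next
      fix F1 F2
      assume F2: "F2 \<subseteq> E"
        and deg: "\<And>x. int (degree F2 x) = int (degree Y x) - unit v (2 * 1) x"
        and dev: "deviation V f F2 = deviation V f Y + \<bar>int (degree Y v) - 2 * 1 - f v\<bar> - \<bar>int (degree Y v) - f v\<bar>"
      show ?thesis
      proof (cases "int (degree Y v) = f v + 1")
        case True
        then have "optimal V E f F2" using optimal_if_deviation_le[OF above(1) F2] dev by simp
        then show ?thesis using not_below[of F2] deg[of v] True by (simp add: unit_def)
      next
        case False
        then have "deviation V f F2 = deviation V f Y - 2" using dev above(2) by simp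
        then show ?thesis using min[OF F2] by simp
      qed
    next
      fix F1 F2 w t
      assume F: "F1 \<subseteq> E" "F2 \<subseteq> E" and w: "w \<noteq> v"
        and deg: "\<And>x. int (degree F1 x) = int (degree F x) + unit v 1 x + unit w t x"
        and dev: "deviation V f F1 + deviation V f F2 \<le> deviation V f F + deviation V f Y
       + (\<bar>int (degree F v) + 1 - f v\<bar> - \<bar>int (degree F v) - f v\<bar>)
       + (\<bar>int (degree Y v) - 1 - f v\<bar> - \<bar>int (degree Y v) - f v\<bar>)"
      have d: "int (degree F1 v) = int (degree F v) + 1" using deg[of v] w by (simp add: unit_def)
      have "deviation V f F1 \<ge> deviation V f Y + 2 * (f v - int (degree F1 v))"
        by (rule less.hyps) (use d lt F in auto)
      moreover have "\<bar>int (degree F v) + 1 - f v\<bar> - \<bar>int (degree F v) - f v\<bar> = - 1"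
        "\<bar>int (degree Y v) - 1 - f v\<bar> - \<bar>int (degree Y v) - f v\<bar> = - 1"
        using lt above(2) by auto
      ultimately show ?thesis using dev d min[OF F(2)] by simp
    qed
  qed
qed

lemma simple_graph_delete:
  "simple_graph V E \<Longrightarrow> simple_graph (V - {v}) {e \<in> E. v \<notin> e}"
  unfolding simple_graph_def by auto

text \<open>Subgraphs of the graph without \<open>v\<close> are the subgraphs of degree \<open>0\<close> at \<open>v\<close>. By \<open>excess_vertex_bound\<close>
  their deviation outside \<open>v\<close> is at least the minimum deviation of the whole graph plus \<open>f v\<close>; and adding \<open>v\<close> to \<open>S\<close> raises the
  surplus by exactly \<open>f v\<close>.\<close>

lemma certified_if_excess_vertex:
  assumes G: "simple_graph V E" and v: "v \<in> V"
    and above: "optimal V E f Y" "int (degree Y v) > f v"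
    and not_below: "\<And>F. optimal V E f F \<Longrightarrow> int (degree F v) \<ge> f v"
    and cert: "certified (V - {v}) {e \<in> E. v \<notin> e} f"
  shows "certified V E f"
proof -
  have finV: "finite V" using G unfolding simple_graph_def by blast
  define E' where "E' = {e \<in> E. v \<notin> e}"
  obtain F S T and c :: "'a \<Rightarrow> 'a set" where F: "F \<subseteq> E'" and sep: "separation (V - {v}) E' S T c"
    and sur: "surplus (V - {v}) E' f S T c \<le> - deviation (V - {v}) f F"
    using cert unfolding certified_def E'_def by blast
  have ST: "S \<subseteq> V - {v}" "T \<subseteq> V - {v}" "S \<inter> T = {}" using sep unfolding separation_def by auto
  have rest: "V - insert v S - T = V - {v} - S - T" by blast
  have "{x, y} \<in> E' \<longleftrightarrow> {x, y} \<in> E" if "x \<noteq> v" "y \<noteq> v" for x y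
    using that unfolding E'_def by auto
  then have "separation V E (insert v S) T c"
    using sep v unfolding separation_def rest by auto
  moreover have nb: "neighbours E' u = neighbours E u - {v}" if "u \<noteq> v" for u
    using that unfolding neighbours_def E'_def by auto
  have "neighbours E' u \<inter> T = neighbours E u \<inter> T" if "u \<noteq> v" for u using nb[OF that] ST by auto
  then have "charge E' f T u = charge E f T u" if "u \<noteq> v" for u using that unfolding charge_def by simp
  then have "(\<Sum>u \<in> {u \<in> V - {v} - S - T. c u = l}. charge E' f T u) =
      (\<Sum>u \<in> {u \<in> V - {v} - S - T. c u = l}. charge E f T u)" for l
    by (intro sum.cong) auto
  then have odd: "odd_labels V E f (insert v S) T c = odd_labels (V - {v}) E' f S T c"
    unfolding odd_labels_def rest by simp
  have "(\<Sum>t\<in>T. int (card (neighbours E t - insert v S))) = (\<Sum>t\<in>T. int (card (neighbours E' t - S)))"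
  proof (rule sum.cong)
    fix t assume "t \<in> T"
    then have "neighbours E' t = neighbours E t - {v}" using nb ST by blast
    then have "neighbours E t - insert v S = neighbours E' t - S" by blast
    then show "int (card (neighbours E t - insert v S)) = int (card (neighbours E' t - S))" by simp
  qed simp
  moreover have "finite S" "v \<notin> S" using ST finV finite_subset[of S V] by auto
  ultimately have sur': "surplus V E f (insert v S) T c = f v + surplus (V - {v}) E' f S T c"
    unfolding surplus_def odd by simp
  have FE: "F \<subseteq> E" using F unfolding E'_def by blast
  have "{e \<in> F. v \<in> e} = {}" using F unfolding E'_def by blast
  then have d0: "degree F v = 0" unfolding degree_def by (simp only: card.empty)
  have "deviation V f F = \<bar>f v\<bar> + deviation (V - {v}) f F"
    unfolding deviation_def using finV v d0 by (simp add: sum.remove)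
  moreover have "deviation V f Y \<le> deviation V f F" using above(1) FE unfolding optimal_def by blast
  moreover have "f v \<ge> 0 \<Longrightarrow> deviation V f Y + 2 * f v \<le> deviation V f F"
    using excess_vertex_bound[OF G v above not_below FE] d0 by simp
  ultimately have "deviation V f Y + f v \<le> deviation (V - {v}) f F" by linarith
  then have "surplus V E f (insert v S) T c \<le> - deviation V f Y" using sur sur' by simp
  moreover have "Y \<subseteq> E" using above(1) unfolding optimal_def by blast
  ultimately show ?thesis unfolding certified_def
    using \<open>separation V E (insert v S) T c\<close> by blast
qed

lemma degree_complement:
  assumes "simple_graph V E" "F \<subseteq> E"
  shows "degree E v = degree (E - F) v + degree F v"
  using degree_Un_Int[of "E - F" F v] assms(2) simple_graph_finite_edges[OF assms(1)]
    finite_subset[OF assms(2)]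
  by (simp add: Un_absorb2 degree_def)

lemma deviation_complement:
  assumes "simple_graph V E" "F \<subseteq> E"
  shows "deviation V (\<lambda>v. int (degree E v) - f v) (E - F) = deviation V f F"
  unfolding deviation_def using degree_complement[OF assms] by (intro sum.cong) auto

lemma optimal_complement:
  assumes "simple_graph V E" "optimal V E f F"
  shows "optimal V E (\<lambda>v. int (degree E v) - f v) (E - F)"
  unfolding optimal_def
proof (intro conjI allI impI)
  fix H assume H: "H \<subseteq> E"
  then have "E - (E - H) = H" by blast
  then have "deviation V (\<lambda>v. int (degree E v) - f v) H = deviation V f (E - H)"
    using deviation_complement[OF assms(1), of "E - H" f] by simp
  moreover have "F \<subseteq> E" "deviation V f F \<le> deviation V f (E - H)"
    using assms(2) unfolding optimal_def by blast+
  ultimately show "deviation V (\<lambda>v. int (degree E v) - f v) (E - F) \<le> deviation V (\<lambda>v. int (degree E v) - f v) H"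
    using deviation_complement[OF assms(1)] by simp
qed blast

text \<open>The number of edges between \<open>S\<close> and \<open>T\<close> is symmetric, which settles the sums. The two charges of
  a vertex \<open>u\<close> outside \<open>S\<close> and \<open>T\<close> add up to an even number plus the number of neighbours of \<open>u\<close> in its own piece;
  the latter has an even sum over the piece.\<close>

lemma surplus_complement:
  assumes G: "simple_graph V E" and sep: "separation V E S T c"
  shows "surplus V E (\<lambda>v. int (degree E v) - f v) S T c = surplus V E f T S c"
proof -
  define g where "g v = int (degree E v) - f v" for v
  have sub: "S \<subseteq> V" "T \<subseteq> V" "S \<inter> T = {}" "T \<inter> S = {}" using sep unfolding separation_def by auto
  have fin: "finite S" "finite T" using G sub finite_subset unfolding simple_graph_def by auto
  have rest: "V - T - S = V - S - T" by blast
  have deg: "int (degree E v) = int (card (neighbours E v \<inter> S)) + int (card (neighbours E v - S))"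
     "int (degree E v) = int (card (neighbours E v \<inter> T)) + int (card (neighbours E v - T))" for v
    using card_neighbours_split(1)[OF G sub(3,1,2), of v] card_neighbours_split(1)[OF G sub(4,2,1), of v]
    unfolding degree_eq_card_neighbours[OF G] by simp_all
  have "(\<Sum>t\<in>T. int (card (neighbours E t - S))) = (\<Sum>t\<in>T. int (degree E t)) - (\<Sum>t\<in>T. int (card (neighbours E t \<inter> S)))"
    unfolding deg(1) sum.distrib by simp
  moreover have "(\<Sum>t\<in>S. int (card (neighbours E t - T))) = (\<Sum>t\<in>S. int (degree E t)) - (\<Sum>t\<in>S. int (card (neighbours E t \<inter> T)))"
    unfolding deg(2) sum.distrib by simp
  moreover have "odd_labels V E g S T c = odd_labels V E f T S c"
  proof -
    have "even (\<Sum>u\<in>{u \<in> V - S - T. c u = l}. charge E g T u) \<longleftrightarrow>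
       even (\<Sum>u\<in>{u \<in> V - S - T. c u = l}. charge E f S u)" for l
    proof -
      define K where "K = {u \<in> V - S - T. c u = l}"
      have "charge E g T u + charge E f S u =
          2 * (int (card (neighbours E u \<inter> S)) + int (card (neighbours E u \<inter> T))) + int (card (neighbours E u \<inter> K))"
        if "u \<in> K" for u
      proof -
        have "neighbours E u \<inter> (V - S - T) = neighbours E u \<inter> K"
          using sep that unfolding separation_def K_def neighbours_def by auto
        then show ?thesis
          using deg(1)[of u] card_neighbours_split(2)[OF G sub(3,1,2), of u] unfolding charge_def g_def by simp
      qed
      then have "(\<Sum>u\<in>K. charge E g T u) + (\<Sum>u\<in>K. charge E f S u) =
        2 * (\<Sum>u\<in>K. int (card (neighbours E u \<inter> S)) + int (card (neighbours E u \<inter> T)))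
          + (\<Sum>u\<in>K. int (card (neighbours E u \<inter> K)))"
        unfolding sum_distrib_left sum.distrib[symmetric] by (rule sum.cong[OF refl])
      moreover have "even (\<Sum>u\<in>K. int (card (neighbours E u \<inter> K)))"
        by (rule even_sum_inner_degree[OF G]) (auto simp: K_def)
      ultimately have "even ((\<Sum>u\<in>K. charge E g T u) + (\<Sum>u\<in>K. charge E f S u))" by simp
      then show ?thesis unfolding K_def[symmetric] by simp
    qed
    then show ?thesis unfolding odd_labels_def rest by simp
  qed
  ultimately show ?thesis
    unfolding surplus_def g_def[symmetric] sum_card_neighbours_swap[OF fin(2,1)]
    by (simp add: g_def sum_subtractf)
qed

lemma certified_complement:
  assumes G: "simple_graph V E" and cert: "certified V E (\<lambda>v. int (degree E v) - f v)"
  shows "certified V E f"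
proof -
  define g where "g v = int (degree E v) - f v" for v
  obtain F S T and c :: "'a \<Rightarrow> 'a set" where F: "F \<subseteq> E" and sep: "separation V E S T c"
    and sur: "surplus V E g S T c \<le> - deviation V g F"
    using cert unfolding certified_def g_def by blast
  have "E - (E - F) = F" using F by blast
  then have "deviation V g F = deviation V f (E - F)"
    using deviation_complement[OF G, of "E - F" f] unfolding g_def by simp
  moreover have "surplus V E g S T c = surplus V E f T S c"
    using surplus_complement[OF G sep] unfolding g_def .
  moreover have "separation V E T S c" using sep unfolding separation_def by blast
  ultimately show ?thesis unfolding certified_def using sur by (metis Diff_subset)
qed

text \<open>Induction on the number of vertices. A vertex that is sometimes below but never above its target
  is sometimes above but never below the complementary target.\<close>

theorem factor_min_max:
  "simple_graph V E \<Longrightarrow> certified V E f"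
proof (induction "card V" arbitrary: V E f rule: less_induct)
  case (less V E f)
  note G = less.prems
  have smaller: "certified (V - {v}) {e \<in> E. v \<notin> e} g" if "v \<in> V" for v g
  proof (rule less.hyps[OF _ simple_graph_delete[OF G]])
    show "card (V - {v}) < card V" using that G unfolding simple_graph_def by (meson card_Diff1_less)
  qed
  show ?case
  proof (cases "balanced V E f")
    case True
    then show ?thesis by (rule certified_if_balanced[OF G])
  next
    case False
    then obtain v where v: "v \<in> V" "(\<exists>F. optimal V E f F \<and> int (degree F v) < f v) \<noteq>
     (\<exists>F. optimal V E f F \<and> int (degree F v) > f v)" unfolding balanced_def by blast
    show ?thesis
    proof (cases "\<exists>F. optimal V E f F \<and> int (degree F v) > f v")
      case True
      then obtain Y where Y: "optimal V E f Y" "int (degree Y v) > f v" by blast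
      have "int (degree F v) \<ge> f v" if "optimal V E f F" for F using v(2) True that by (meson not_le)
      then show ?thesis using certified_if_excess_vertex[OF G v(1) Y _ smaller[OF v(1)]] by blast
    next
      case above: False
      then obtain Y where Y: "optimal V E f Y" "int (degree Y v) < f v" using v(2) by blast
      define g where "g w = int (degree E w) - f w" for w
      note compl = degree_complement[OF G]
      have "Y \<subseteq> E" using Y(1) unfolding optimal_def by blast
      then have "int (degree (E - Y) v) > g v" using Y(2) compl[of Y v] unfolding g_def by simp
      moreover have "optimal V E g (E - Y)" unfolding g_def by (rule optimal_complement[OF G Y(1)])
      moreover have "int (degree F v) \<ge> g v" if F: "optimal V E g F" for F
      proof -
        have "optimal V E (\<lambda>v. int (degree E v) - g v) (E - F)" by (rule optimal_complement[OF G F])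
        then have "optimal V E f (E - F)" unfolding g_def by simp
        then have "int (degree (E - F) v) \<le> f v" using above by (meson not_le)
        moreover have "F \<subseteq> E" using F unfolding optimal_def by blast
        ultimately show ?thesis using compl[of F v] unfolding g_def by simp
      qed
      ultimately have "certified V E g"
        using certified_if_excess_vertex[OF G v(1) _ _ _ smaller[OF v(1)]] by blast
      then show ?thesis using certified_complement[OF G] unfolding g_def by blast
    qed
  qed
qed


section \<open>Extremal barriers\<close>

text \<open>Only the piece of \<open>u\<close> changes, so at most one odd piece is lost. Each neighbour of \<open>u\<close> in \<open>T\<close> has
  one neighbour less outside \<open>S\<close>.\<close>

lemma surplus_grow_S:
  assumes G: "simple_graph V E" and sep: "separation V E S T c" and u: "u \<in> V - S - T"
  shows "separation V E (insert u S) T c"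
    and "surplus V E f (insert u S) T c
      \<le> surplus V E f S T c + f u - int (card (neighbours E u \<inter> T)) + 1"
proof -
  have sub: "S \<subseteq> V" "T \<subseteq> V" "S \<inter> T = {}" using sep unfolding separation_def by auto
  have fin: "finite V" "finite S" "finite T" using G sub finite_subset unfolding simple_graph_def by auto
  show "separation V E (insert u S) T c" using sep u unfolding separation_def by auto
  have "odd_labels V E f S T c - {c u} \<subseteq> odd_labels V E f (insert u S) T c"
  proof
    fix l assume l: "l \<in> odd_labels V E f S T c - {c u}"
    then have "{x \<in> V - insert u S - T. c x = l} = {x \<in> V - S - T. c x = l}" by auto
    then show "l \<in> odd_labels V E f (insert u S) T c" using l unfolding odd_labels_def by simp
  qed
  then have "card (odd_labels V E f S T c - {c u}) \<le> card (odd_labels V E f (insert u S) T c)"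
    by (rule card_mono[OF finite_odd_labels[OF fin(1)]])
  then have q: "int (card (odd_labels V E f S T c)) - 1 \<le> int (card (odd_labels V E f (insert u S) T c))"
    using diff_card_le_card_Diff[of "{c u}" "odd_labels V E f S T c"] by simp
  have "int (card (neighbours E t - S)) = int (card (neighbours E t - insert u S)) + int (card (neighbours E t \<inter> {u}))" for t
  proof -
    have "(neighbours E t - S) \<inter> {u} = neighbours E t \<inter> {u}"
      "neighbours E t - S - {u} = neighbours E t - insert u S" using u by auto
    then show ?thesis
      using card_Int_Diff[of "neighbours E t - S" "{u}"] neighbours_in(2)[OF G, of t] by simp
  qed
  then have "(\<Sum>t\<in>T. int (card (neighbours E t - S))) =
    (\<Sum>t\<in>T. int (card (neighbours E t - insert u S))) + (\<Sum>t\<in>T. int (card (neighbours E t \<inter> {u})))"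
    by (simp add: sum.distrib)
  also have "(\<Sum>t\<in>T. int (card (neighbours E t \<inter> {u}))) = int (card (neighbours E u \<inter> T))"
    using sum_card_neighbours_swap[OF fin(3), of "{u}" E] by simp
  finally show "surplus V E f (insert u S) T c
      \<le> surplus V E f S T c + f u - int (card (neighbours E u \<inter> T)) + 1"
    using q u fin(2) unfolding surplus_def by simp
qed

text \<open>All pieces are merged, since \<open>t\<close> may be adjacent to each of them; at worst all odd pieces are lost.\<close>

lemma surplus_shrink_T:
  assumes G: "simple_graph V E" and sep: "separation V E S T c" and t: "t \<in> T"
  shows "separation V E S (T - {t}) (\<lambda>_. l)"
    and "surplus V E f S (T - {t}) (\<lambda>_. l) \<le> surplus V E f S T c + f t
      - int (card (neighbours E t - S)) + int (card (odd_labels V E f S T c))"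
proof -
  have "T \<subseteq> V" using sep unfolding separation_def by auto
  then have "finite T" using G finite_subset unfolding simple_graph_def by auto
  then show "surplus V E f S (T - {t}) (\<lambda>_. l) \<le> surplus V E f S T c + f t
      - int (card (neighbours E t - S)) + int (card (odd_labels V E f S T c))"
    using t unfolding surplus_def by (simp add: sum.remove)
  show "separation V E S (T - {t}) (\<lambda>_. l)" using sep unfolding separation_def by auto
qed

text \<open>Take a barrier with \<open>|S| - |T|\<close> as large as possible. If one of the two bounds failed, then moving the
  offending vertex from \<open>T\<close> to the rest or from the rest to \<open>S\<close> would raise the surplus by at most \<open>1\<close>, and
  the surplus would remain negative because it was at most \<open>-2\<close> by parity.\<close>

lemma extremal_barrier:
  fixes V :: "'a set"
  assumes G: "simple_graph V E" and ev: "even (\<Sum>v\<in>V. f v)"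
    and none: "\<not> (\<exists>F \<subseteq> E. \<forall>v\<in>V. int (degree F v) = f v)"
  obtains S T and c :: "'a \<Rightarrow> 'a set" where "separation V E S T c" "surplus V E f S T c \<le> -2"
    "\<And>t. t \<in> T \<Longrightarrow> int (card (neighbours E t - S)) \<le> f t + int (card (odd_labels V E f S T c)) - 2"
    "\<And>u. u \<in> V - S - T \<Longrightarrow> int (card (neighbours E u \<inter> T)) < f u"
proof -
  have finV: "finite V" using G unfolding simple_graph_def by blast
  define P where "P = (\<lambda>(S, T, c :: 'a \<Rightarrow> 'a set). separation V E S T c \<and> surplus V E f S T c < 0)"
  \<comment> \<open>up to a constant, this is \<open>|T| - |S|\<close>, as a natural number\<close>
  define m where "m = (\<lambda>(S, T :: 'a set, c :: 'a \<Rightarrow> 'a set). card (V - S) + card T)"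
  obtain F S T and c :: "'a \<Rightarrow> 'a set" where F: "F \<subseteq> E" "separation V E S T c"
    "surplus V E f S T c \<le> - deviation V f F"
    using factor_min_max[OF G, of f] unfolding certified_def by blast
  have "deviation V f F \<noteq> 0"
  proof
    assume "deviation V f F = 0"
    then have "\<forall>v\<in>V. int (degree F v) = f v"
      unfolding deviation_def using finV by (simp add: sum_nonneg_eq_0_iff)
    then show False using none F(1) by blast
  qed
  moreover have "deviation V f F \<ge> 0" unfolding deviation_def by (simp add: sum_nonneg)
  ultimately have "P (S, T, c)" using F unfolding P_def by simp
  from ex_has_least_nat[of P, OF this, of m]
  obtain S T and c :: "'a \<Rightarrow> 'a set" where "P (S, T, c)" and "\<forall>y. P y \<longrightarrow> m (S, T, c) \<le> m y" by auto
  then have sep: "separation V E S T c" and neg: "surplus V E f S T c < 0"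
    and min: "\<forall>y. P y \<longrightarrow> m (S, T, c) \<le> m y"
    unfolding P_def by auto
  have least: "card (V - S) + card T \<le> card (V - S') + card T'"
    if "separation V E S' T' c'" "surplus V E f S' T' c' < 0" for S' T' and c' :: "'a \<Rightarrow> 'a set"
  proof -
    have "P (S', T', c')" using that unfolding P_def by simp
    then have "m (S, T, c) \<le> m (S', T', c')" using min by blast
    then show ?thesis unfolding m_def by simp
  qed
  have fin: "finite T"
    using sep finV finite_subset[of T V] unfolding separation_def by blast
  have "even (surplus V E f S T c)" using ev surplus_parity[OF G sep, of f] by simp
  moreover have "x \<le> -2" if "x < 0" "even x" for x :: int using that by presburger
  ultimately have two: "surplus V E f S T c \<le> -2" using neg by blast
  show thesis
  proof (rule that[OF sep two])
    fix t assume t: "t \<in> T"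
    note shrink = surplus_shrink_T[OF G sep t]
    have less: "card (T - {t}) < card T" using t fin by (meson card_Diff1_less)
    have "surplus V E f S (T - {t}) (\<lambda>_. {} :: 'a set) \<ge> 0"
    proof (rule ccontr)
      assume "\<not> ?thesis"
      then have "surplus V E f S (T - {t}) (\<lambda>_. {} :: 'a set) < 0" by simp
      from least[OF shrink(1) this] show False using less by linarith
    qed
    then show "int (card (neighbours E t - S)) \<le> f t + int (card (odd_labels V E f S T c)) - 2"
      using shrink(2)[of f "{} :: 'a set"] two by linarith
  next
    fix u assume u: "u \<in> V - S - T"
    note grow = surplus_grow_S[OF G sep u]
    have "V - insert u S \<subset> V - S" using u by blast
    then have less: "card (V - insert u S) < card (V - S)" using finV by (meson finite_Diff psubset_card_mono)
    have "surplus V E f (insert u S) T c \<ge> 0"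
    proof (rule ccontr)
      assume "\<not> ?thesis"
      then have "surplus V E f (insert u S) T c < 0" by simp
      from least[OF grow(1) this] show False using less by linarith
    qed
    then show "int (card (neighbours E u \<inter> T)) < f u" using grow(2)[of f] two by linarith
  qed
qed

text \<open>Besides itself, \<open>u\<close> misses its non-neighbours in \<open>T\<close> and all vertices of the other
  pieces. Each odd piece is nonempty, and all but one of them differ from that of \<open>u\<close>.\<close>

lemma separated_degree_bound:
  assumes G: "simple_graph V E" and sep: "separation V E S T c" and u: "u \<in> V - S - T"
  shows "int (degree E u) + int (card (T - neighbours E u))
    + max 0 (int (card (odd_labels V E f S T c)) - 1) \<le> int (card V) - 1"
proof -
  have finV: "finite V" using G unfolding simple_graph_def by blast
  have TV: "T \<subseteq> V" using sep unfolding separation_def by blast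
  define W where "W = V - S - T - neighbours E u - {u}"
  have finW: "finite W" using finV unfolding W_def by blast
  have "odd_labels V E f S T c - {c u} \<subseteq> c ` W"
  proof
    fix l assume l: "l \<in> odd_labels V E f S T c - {c u}"
    then obtain w where w: "w \<in> V - S - T" "l = c w"
      using odd_labels_subset[of V E f S T c] by blast
    then have "w \<noteq> u" using l by blast
    moreover have "w \<notin> neighbours E u"
      using sep u w l unfolding separation_def neighbours_def by auto
    ultimately show "l \<in> c ` W" using w unfolding W_def by blast
  qed
  then have "card (odd_labels V E f S T c - {c u}) \<le> card W"
    using card_mono[OF finite_imageI[OF finW]] card_image_le[OF finW] by (meson order_trans)
  then have W: "max 0 (int (card (odd_labels V E f S T c)) - 1) \<le> int (card W)"
    using diff_card_le_card_Diff[of "{c u}" "odd_labels V E f S T c"] by simp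
  have N: "neighbours E u \<subseteq> V - {u}" "finite (neighbours E u)" using neighbours_in[OF G] by auto
  have finT: "finite (T - neighbours E u)" using TV finV finite_subset by blast
  have "card (neighbours E u \<union> (T - neighbours E u) \<union> W)
    = card (neighbours E u) + card (T - neighbours E u) + card W"
  proof (subst card_Un_disjoint)
    show "(neighbours E u \<union> (T - neighbours E u)) \<inter> W = {}" unfolding W_def by blast
    show "card (neighbours E u \<union> (T - neighbours E u)) + card W
      = card (neighbours E u) + card (T - neighbours E u) + card W"
      using card_Un_disjoint[OF N(2) finT] by simp
  qed (use N finT finW in auto)
  moreover have "neighbours E u \<union> (T - neighbours E u) \<union> W \<subseteq> V - {u}"
    using N(1) TV u unfolding W_def by blast
  then have "card (neighbours E u \<union> (T - neighbours E u) \<union> W) \<le> card (V - {u})"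
    using finV by (meson card_mono finite_Diff)
  moreover have "card (V - {u}) = card V - 1" "card V \<ge> 1"
    using u finV by (auto simp: Suc_le_eq card_gt_0_iff)
  ultimately have "int (card (neighbours E u)) + int (card (T - neighbours E u)) + int (card W) \<le> int (card V) - 1"
    by linarith
  then show ?thesis using W unfolding degree_eq_card_neighbours[OF G] by linarith
qed

section \<open>Sorted degree sequences\<close>

text \<open>Outside their intersection, the initial segment and \<open>I\<close> have the same number of indices, and the
  last entry \<open>p\<close> of the segment separates the values on both sides.\<close>

lemma sorted_initial_sum_le:
  fixes xs :: "int list"
  assumes "sorted xs" "I \<subseteq> {..<length xs}"
  shows "(\<Sum>i<card I. xs ! i) \<le> (\<Sum>i\<in>I. xs ! i)"
proof (cases "I = {}")
  case False
  define m where "m = card I"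
  have fin: "finite I" using assms(2) finite_subset by blast
  have m: "m > 0" "m \<le> length xs"
    using False fin card_mono[OF _ assms(2)] unfolding m_def by (auto simp: card_gt_0_iff)
  define p where "p = xs ! (m - 1)"
  have "(\<Sum>i\<in>{..<m} - I. xs ! i) \<le> (\<Sum>i\<in>{..<m} - I. p)"
    unfolding p_def by (rule sum_mono, rule sorted_nth_mono[OF assms(1)]) (use m in auto)
  also have "\<dots> = (\<Sum>i\<in>I - {..<m}. p)"
  proof -
    have "card ({..<m} - I) + card ({..<m} \<inter> I) = m"
      using card_Int_Diff[of "{..<m}" I] by simp
    moreover have "card (I - {..<m}) + card (I \<inter> {..<m}) = m"
      using card_Int_Diff[OF fin, of "{..<m}"] unfolding m_def by simp
    ultimately have "card ({..<m} - I) = card (I - {..<m})" by (simp add: Int_commute)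
    then show ?thesis by simp
  qed
  also have "\<dots> \<le> (\<Sum>i\<in>I - {..<m}. xs ! i)"
    unfolding p_def by (rule sum_mono, rule sorted_nth_mono[OF assms(1)]) (use assms(2) in auto)
  finally have "(\<Sum>i\<in>{..<m} - I. xs ! i) \<le> (\<Sum>i\<in>I - {..<m}. xs ! i)" .
  moreover have "(\<Sum>i<m. xs ! i) = (\<Sum>i\<in>{..<m} - I. xs ! i) + (\<Sum>i\<in>{..<m} \<inter> I. xs ! i)"
    by (subst add.commute, rule sum.Int_Diff) simp
  moreover have "(\<Sum>i\<in>I. xs ! i) = (\<Sum>i\<in>I - {..<m}. xs ! i) + (\<Sum>i\<in>I \<inter> {..<m}. xs ! i)"
    by (subst add.commute, rule sum.Int_Diff[OF fin])
  ultimately show ?thesis unfolding m_def[symmetric] by (simp add: Int_commute)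
qed simp

lemma sorted_entry_le:
  fixes xs :: "int list"
  assumes "sorted xs" "I \<subseteq> {..<length xs}" "I \<noteq> {}" "\<And>i. i \<in> I \<Longrightarrow> xs ! i \<le> r"
  shows "xs ! (card I - 1) \<le> r"
proof -
  have fin: "finite I" using assms(2) finite_subset by blast
  have "\<not> I \<subseteq> {..<card I - 1}"
  proof
    assume "I \<subseteq> {..<card I - 1}"
    from card_mono[OF _ this] have "card I \<le> card I - 1" by simp
    moreover have "card I > 0" using assms(3) fin by (simp add: card_gt_0_iff)
    ultimately show False by linarith
  qed
  then obtain i where i: "i \<in> I" "card I - 1 \<le> i" unfolding subset_iff lessThan_iff by (meson not_le)
  then have "xs ! (card I - 1) \<le> xs ! i"
    using assms(2) by (intro sorted_nth_mono[OF assms(1)]) auto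
  then show ?thesis using assms(4)[OF i(1)] by simp
qed

text \<open>The vertices can be listed so that their degrees appear in the order of the sequence; this turns
  statements about sets of vertices into statements about sets of indices.\<close>

lemma realization_enumeration:
  assumes "realization V E \<pi>"
  obtains h where "bij_betw h {..<length \<pi>} V" "\<And>i. i < length \<pi> \<Longrightarrow> \<pi> ! i = int (degree E (h i))"
    "sorted \<pi>"
proof -
  have finV: "finite V" and \<pi>: "\<pi> = degree_sequence V E"
    using assms unfolding realization_def simple_graph_def by auto
  obtain us where us: "set us = V" "distinct us" using finite_distinct_list[OF finV] by blast
  define vs where "vs = sort_key (\<lambda>v. int (degree E v)) us"
  have vs: "set vs = V" "distinct vs" "mset vs = mset_set V"
    using us unfolding vs_def by (auto simp: mset_set_set)
  have "sorted (map (\<lambda>v. int (degree E v)) vs)" unfolding vs_def by simp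
  moreover have "mset (map (\<lambda>v. int (degree E v)) vs) = image_mset (\<lambda>v. int (degree E v)) (mset_set V)"
    using vs(3) by simp
  ultimately have eq: "\<pi> = map (\<lambda>v. int (degree E v)) vs"
    unfolding \<pi> degree_sequence_def
    by (metis sorted_list_of_multiset_mset sorted_sort_id)
  show thesis
  proof (rule that[of "(!) vs"])
    show "bij_betw ((!) vs) {..<length \<pi>} V"
      by (rule bij_betw_nth) (use vs eq in auto)
    show "sorted \<pi>" using \<open>sorted (map _ vs)\<close> eq by simp
  qed (simp add: eq)
qed

lemma sum_seq_entry: "(\<Sum>i=1..int m. seq_entry \<pi> i) = (\<Sum>i<m. \<pi> ! i)"
  by (rule sum.reindex_bij_witness[of _ "\<lambda>i. int i + 1" "\<lambda>i. nat (i - 1)"])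
    (auto simp: seq_entry_def)

lemma realization_length:
  assumes "realization V E \<pi>" shows "length \<pi> = card V"
  using assms unfolding realization_def degree_sequence_def
  by (metis size_image_mset size_mset size_mset_set mset_sorted_list_of_multiset)

lemma realization_initial_sum_le:
  assumes "realization V E \<pi>" "W \<subseteq> V"
  shows "(\<Sum>i=1..int (card W). seq_entry \<pi> i) \<le> (\<Sum>v\<in>W. int (degree E v))"
proof (rule realization_enumeration[OF assms(1)])
  fix h assume h: "bij_betw h {..<length \<pi>} V" and deg: "\<And>i. i < length \<pi> \<Longrightarrow> \<pi> ! i = int (degree E (h i))"
    and sorted: "sorted \<pi>"
  define I where "I = {i \<in> {..<length \<pi>}. h i \<in> W}"
  have inj: "inj_on h I" using h unfolding bij_betw_def I_def by (auto intro: inj_on_subset)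
  have img: "h ` I = W" using h assms(2) unfolding bij_betw_def I_def by auto
  have "(\<Sum>i<card I. \<pi> ! i) \<le> (\<Sum>i\<in>I. \<pi> ! i)"
    by (rule sorted_initial_sum_le[OF sorted]) (auto simp: I_def)
  also have "\<dots> = (\<Sum>i\<in>I. int (degree E (h i)))"
    by (rule sum.cong) (auto simp: I_def deg)
  also have "\<dots> = (\<Sum>v\<in>W. int (degree E v))"
    using sum.reindex[OF inj, of "\<lambda>v. int (degree E v)"] img by simp
  finally show ?thesis using card_image[OF inj] img unfolding sum_seq_entry by simp
qed

text \<open>The assumption \<open>r \<ge> 0\<close> covers the empty set, for which the entry is \<open>d\<^sub>0 = 0\<close>.\<close>

lemma realization_entry_le:
  assumes "realization V E \<pi>" "W \<subseteq> V" "\<And>v. v \<in> W \<Longrightarrow> int (degree E v) \<le> r" "r \<ge> 0"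
  shows "seq_entry \<pi> (int (card W)) \<le> r"
proof (cases "W = {}")
  case True
  then show ?thesis using assms(4) by (simp add: seq_entry_def)
next
  case False
  show ?thesis
  proof (rule realization_enumeration[OF assms(1)])
    fix h assume h: "bij_betw h {..<length \<pi>} V" and deg: "\<And>i. i < length \<pi> \<Longrightarrow> \<pi> ! i = int (degree E (h i))"
      and sorted: "sorted \<pi>"
    define I where "I = {i \<in> {..<length \<pi>}. h i \<in> W}"
    have inj: "inj_on h I" using h unfolding bij_betw_def I_def by (auto intro: inj_on_subset)
    have img: "h ` I = W" using h assms(2) unfolding bij_betw_def I_def by auto
    have fin: "finite I" unfolding I_def by simp
    have ne: "I \<noteq> {}" using img False by blast
    have "\<pi> ! (card I - 1) \<le> r"
      by (rule sorted_entry_le[OF sorted _ ne]) (use assms(3) deg in \<open>auto simp: I_def\<close>)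
    moreover have "card I = card W" using card_image[OF inj] img by simp
    moreover have "card I > 0" using fin ne by (simp add: card_gt_0_iff)
    moreover have "nat (int (card W) - 1) = card W - 1" by simp
    ultimately show ?thesis unfolding seq_entry_def by simp
  qed
qed

section \<open>The degree condition\<close>

theorem theorem4p3:
  fixes \<pi> :: "int list" and k :: nat and n :: int and d :: "int \<Rightarrow> int"
  defines "n \<equiv> int (length \<pi>)"
  defines "d \<equiv> seq_entry \<pi>"
  assumes "graphical \<pi>"
    and "k \<ge> 2"
    and "even (int k * n)"
    and "d 1 \<ge> int k"
    and "\<And>a b q :: int.
      \<lbrakk>0 \<le> a; 2 * a < n; 0 \<le> b; b \<le> n - a;
       max 0 (a * (int k - b) + 2) \<le> q; q \<le> n - a - b;
       (\<Sum>i=1..b. d i) \<le> int k * b + a * b - int k * a + q - 2\<rbrakk> \<Longrightarrow>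
      (let r = a + int k + q - 2;
           s = n - max 0 (b - int k + 1) - max 0 (q - 1) - 1
       in (r \<le> s \<and> d b \<le> r) \<or> (r > s \<and> d (n - a - b) \<le> s)
            \<longrightarrow> d (n - a) \<ge> max r s + 1)"
  shows "forcibly_k_factor_graphical TYPE('a) k \<pi>"
  unfolding forcibly_k_factor_graphical_def
proof (intro allI impI, rule ccontr)
  fix V :: "'a set" and E
  assume real: "realization V E \<pi>" and none: "\<not> (\<exists>F. is_k_factor k V E F)"
  have G: "simple_graph V E" using real unfolding realization_def by blast
  have finV: "finite V" using G unfolding simple_graph_def by blast
  have n: "n = int (card V)" unfolding n_def using realization_length[OF real] by simp
  have "even (\<Sum>v\<in>V. int k)" using \<open>even (int k * n)\<close> n by (simp add: mult.commute)
  moreover have "\<not> (\<exists>F \<subseteq> E. \<forall>v\<in>V. int (degree F v) = int k)"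
    using none unfolding is_k_factor_def by simp
  ultimately obtain S T and c :: "'a \<Rightarrow> 'a set" where sep: "separation V E S T c"
    and sur: "surplus V E (\<lambda>_. int k) S T c \<le> -2"
    and T_bound: "\<And>t. t \<in> T \<Longrightarrow> int (card (neighbours E t - S))
      \<le> int k + int (card (odd_labels V E (\<lambda>_. int k) S T c)) - 2"
    and U_bound: "\<And>u. u \<in> V - S - T \<Longrightarrow> int (card (neighbours E u \<inter> T)) < int k"
    using extremal_barrier[OF G, of "\<lambda>_. int k"] by blast
  have sub: "S \<subseteq> V" "T \<subseteq> V" "S \<inter> T = {}" using sep unfolding separation_def by auto
  have fin: "finite S" "finite T" using sub finV finite_subset[of _ V] by auto
  define U where "U = V - S - T"
  define a where "a = int (card S)"
  define b where "b = int (card T)"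
  define q where "q = int (card (odd_labels V E (\<lambda>_. int k) S T c))"
  define X where "X = (\<Sum>t\<in>T. int (card (neighbours E t - S)))"
  have nonneg: "a \<ge> 0" "b \<ge> 0" "q \<ge> 0" "X \<ge> 0" unfolding a_def b_def q_def X_def by (auto intro: sum_nonneg)
  have "card (V - S) = card V - card S" using sub fin by (simp add: card_Diff_subset)
  moreover have "card U = card (V - S) - card T"
    unfolding U_def using sub fin by (intro card_Diff_subset) auto
  moreover have "card S \<le> card V" "card T \<le> card (V - S)"
    using sub finV by (auto intro!: card_mono)
  ultimately have VS: "int (card (V - S)) = n - a" and U: "int (card U) = n - a - b"
    unfolding n a_def b_def by auto
  have "card (odd_labels V E (\<lambda>_. int k) S T c) \<le> card U"
    using card_mono[OF _ odd_labels_subset[of V E "\<lambda>_. int k" S T c]] card_image_le[of U c] finV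
    unfolding U_def by (meson finite_Diff finite_imageI order_trans)
  then have qU: "q \<le> n - a - b" using U unfolding q_def by linarith
  have bn: "b \<le> n - a" using qU nonneg by linarith
  have theta: "int k * a - int k * b + X - q \<le> -2"
    using sur unfolding surplus_def X_def q_def a_def b_def by (simp add: mult.commute)
  have deg_T: "int (degree E t) \<le> a + int (card (neighbours E t - S))" for t
  proof -
    have "card (neighbours E t \<inter> S) \<le> card S" using fin by (intro card_mono) auto
    then show ?thesis using card_neighbours_split(1)[OF G sub(3,1,2), of t]
      unfolding degree_eq_card_neighbours[OF G] a_def by linarith
  qed
  have "(\<Sum>t\<in>T. int (degree E t)) \<le> (\<Sum>t\<in>T. a + int (card (neighbours E t - S)))"
    by (rule sum_mono) (rule deg_T)
  then have sum_T: "(\<Sum>t\<in>T. int (degree E t)) \<le> a * b + X"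
    unfolding X_def b_def by (simp add: sum.distrib mult.commute)
  have min_deg: "int k \<le> int (degree E v)" if "v \<in> V" for v
    using realization_initial_sum_le[OF real, of "{v}"] that \<open>d 1 \<ge> int k\<close> unfolding d_def by simp
  have "(\<Sum>t\<in>T. int k) \<le> (\<Sum>t\<in>T. int (degree E t))"
    by (rule sum_mono) (use min_deg sub in auto)
  then have low_T: "int k * b \<le> a * b + X" using sum_T unfolding b_def by (simp add: mult.commute)
  have k: "int k \<ge> 2" using \<open>k \<ge> 2\<close> by simp
  \<comment> \<open>The inequality \<open>k a + 2 \<le> k b + q\<close> and \<open>q \<le> n - a - b\<close> give \<open>k a < (k - 1) b + n - a \<le> k (n - a)\<close>.\<close>
  have p1: "2 * a < n"
  proof -
    have "(int k - 1) * b \<le> (int k - 1) * (n - a)" using bn k by (intro mult_left_mono) auto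
    then have "int k * a < int k * (n - a)" using theta qU nonneg by (simp add: algebra_simps)
    then show ?thesis using k by simp
  qed
  \<comment> \<open>All degrees on \<open>T\<close> are at least \<open>k\<close>, and at most \<open>a\<close> edges go from each vertex of \<open>T\<close> to \<open>S\<close>.\<close>
  have p2: "max 0 (a * (int k - b) + 2) \<le> q"
    using theta low_T nonneg by (simp add: algebra_simps)
  have "(\<Sum>i=1..b. d i) \<le> (\<Sum>t\<in>T. int (degree E t))"
    unfolding d_def b_def by (rule realization_initial_sum_le[OF real sub(2)])
  then have p3: "(\<Sum>i=1..b. d i) \<le> int k * b + a * b - int k * a + q - 2"
    using sum_T theta by linarith
  define r where "r = a + int k + q - 2"
  define s where "s = n - max 0 (b - int k + 1) - max 0 (q - 1) - 1"
  have key: "(r \<le> s \<and> d b \<le> r) \<or> (r > s \<and> d (n - a - b) \<le> s) \<longrightarrow> d (n - a) \<ge> max r s + 1"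
    using assms(7)[OF nonneg(1) p1 nonneg(2) bn p2 qU p3] unfolding Let_def r_def s_def .
  have T_r: "int (degree E t) \<le> r" if "t \<in> T" for t
    using deg_T[of t] T_bound[OF that] unfolding r_def q_def by linarith
  have U_s: "int (degree E u) \<le> s" if "u \<in> U" for u
  proof -
    have "card (T - neighbours E u) + card (neighbours E u \<inter> T) = card T"
      using card_Int_Diff[OF fin(2), of "neighbours E u"] by (simp add: Int_commute)
    then have "max 0 (b - int k + 1) \<le> int (card (T - neighbours E u))"
      using U_bound[of u] that unfolding b_def U_def by linarith
    then show ?thesis
      using separated_degree_bound[OF G sep, of u "\<lambda>_. int k"] that
      unfolding s_def U_def n q_def by linarith
  qed
  have r0: "r \<ge> 0" unfolding r_def using nonneg k by linarith
  have s0: "s \<ge> 0"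
    unfolding s_def using nonneg k p1 qU bn by linarith
  have "d b \<le> r"
    unfolding d_def b_def by (rule realization_entry_le[OF real sub(2) T_r r0])
  moreover have "d (n - a - b) \<le> s"
    unfolding d_def U[symmetric] by (rule realization_entry_le[OF real _ U_s s0]) (auto simp: U_def)
  moreover have "d (n - a) \<le> max r s"
    unfolding d_def VS[symmetric]
  proof (rule realization_entry_le[OF real])
    fix v assume "v \<in> V - S"
    then have "v \<in> T \<or> v \<in> U" unfolding U_def by blast
    then show "int (degree E v) \<le> max r s" using T_r[of v] U_s[of v] by linarith
  qed (use r0 in auto)
  ultimately show False using key by linarith
qed

end
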